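(* Let $A$ be a finite dimensional commutative $\mathbb{Q}$-algebra with unit element $1_A$. Let $\Lambda$ be an order in $A$, and let $L\subset\Lambda$ be a $\Lambda$-ideal (not necessarily exact). The set $P_0:=\{p\in\mathbb{P}\mid\Lambda_{(p)}\neq L_{(p)}\}$ is finite. (a) The quotient $\Lambda/L$ is a finite commutative ring with unit element. For each $p\in P_0$ the quotient $\Lambda_{(p)}/L_{(p)}$ is a finite commutative ring with unit element. There is a natural isomorphism $$\Lambda/L\to\prod_{p\in P_0}\Lambda_{(p)}/L_{(p)}$$ of finite commutative rings with unit elements. It induces an isomorphism $$(\Lambda/L)^{unit}\to\prod_{p\in P_0}(\Lambda_{(p)}/L_{(p)})^{unit}$$ of finite commutative multiplicative groups. (b) Fix $p\in P_0$ and an element $a_1\in\Lambda_{(p)}$ with $a_1+L_{(p)}\in(\Lambda_{(p)}/L_{(p)})^{unit}$. There is an element $a_3\in\Lambda\cap\Lambda_{(p)}^{unit}$ with $$a_3+L\in(\Lambda/L)^{unit},\qquad a_3+L_{(p)}=a_1+L_{(p)},\qquad a_3+L_{(q)}=1_A+L_{(q)}\ \text{ for } q\in P_0-\{p\},$$ so the image of $a_3+L\in(\Lambda/L)^{unit}$ under the isomorphism of unit groups in (a) is $a_1+L_{(p)}$ in the factor $(\Lambda_{(p)}/L_{(p)})^{unit}$ and the unit element in each other factor $(\Lambda_{(q)}/L_{(q)})^{unit}$. Especially, the group homomorphism $$\Lambda_{(p)}^{unit}\to(\Lambda_{(p)}/L_{(p)})^{unit}$$ is surjective.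
   Context: A full lattice in $A$ is a finitely generated $\mathbb{Z}$-submodule of $A$ which generates $A$ over $\mathbb{Q}$. An order in $A$ is a full lattice $\Lambda$ with $1_A\in\Lambda$ and $\Lambda\Lambda\subset\Lambda$. For a full lattice $L$, $\mathcal{O}(L):=\{a\in A\mid aL\subset L\}$. A $\Lambda$-ideal is a full lattice $L$ with $\mathcal{O}(L)\supset\Lambda$; it is called exact if $\mathcal{O}(L)=\Lambda$. $\mathbb{P}$ is the set of prime numbers; $\mathbb{Z}_{(p)}\subset\mathbb{Q}$ is the ring of fractions with denominator prime to $p$; $L_{(p)}:=\mathbb{Z}_{(p)}\cdot L\subset A$. $B^{unit}$ is the group of units of a commutative ring $B$ with unit, and $\Lambda_{(p)}^{unit}:=(\Lambda_{(p)})^{unit}$. The natural map in (a) is $a+L\mapsto(a+L_{(p)})_{p\in P_0}$. *)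

theory Defs
  imports "HOL-Algebra.Algebra" "HOL-Computational_Algebra.Primes"
begin

definition rat_ring :: "rat ring"
  where "rat_ring = \<lparr>carrier = UNIV, monoid.mult = (*), one = 1, ring.zero = 0, ring.add = (+)\<rparr>"

text \<open>The \<open>\<rat>\<close>-subspace of \<open>A\<close> generated by \<open>S\<close> is the least submodule containing \<open>S\<close>.\<close>

definition rat_span :: "(rat, 'a, 'm) module_scheme \<Rightarrow> 'a set \<Rightarrow> 'a set"
  where "rat_span A S = \<Inter> {H. submodule H rat_ring A \<and> S \<subseteq> H}"

text \<open>The zero algebra is allowed: \<open>algebra\<close> does not require \<open>\<one> \<noteq> \<zero>\<close>.\<close>

definition fin_dim_comm_rat_algebra :: "(rat, 'a, 'm) module_scheme \<Rightarrow> bool"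
  where "fin_dim_comm_rat_algebra A \<longleftrightarrow>
    algebra rat_ring A \<and>
    (\<exists>B. finite B \<and> B \<subseteq> carrier A \<and> rat_span A B = carrier A)"

text \<open>A \<open>\<int>\<close>-submodule of \<open>A\<close> is the same thing as a subgroup of the additive group of \<open>A\<close>.\<close>

definition full_lattice :: "(rat, 'a, 'm) module_scheme \<Rightarrow> 'a set \<Rightarrow> bool"
  where "full_lattice A L \<longleftrightarrow>
    (\<exists>F. finite F \<and> F \<subseteq> carrier A \<and> L = generate (add_monoid A) F) \<and>
    rat_span A L = carrier A"

definition is_order :: "(rat, 'a, 'm) module_scheme \<Rightarrow> 'a set \<Rightarrow> bool"
  where "is_order A \<Lambda> \<longleftrightarrow>
    full_lattice A \<Lambda> \<and> \<one>\<^bsub>A\<^esub> \<in> \<Lambda> \<and> (\<forall>a\<in>\<Lambda>. \<forall>b\<in>\<Lambda>. a \<otimes>\<^bsub>A\<^esub> b \<in> \<Lambda>)"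

definition multiplier_ring :: "(rat, 'a, 'm) module_scheme \<Rightarrow> 'a set \<Rightarrow> 'a set"
  where "multiplier_ring A L = {a \<in> carrier A. \<forall>x\<in>L. a \<otimes>\<^bsub>A\<^esub> x \<in> L}"

definition order_ideal :: "(rat, 'a, 'm) module_scheme \<Rightarrow> 'a set \<Rightarrow> 'a set \<Rightarrow> bool"
  where "order_ideal A \<Lambda> L \<longleftrightarrow> full_lattice A L \<and> \<Lambda> \<subseteq> multiplier_ring A L"

definition Z_loc :: "nat \<Rightarrow> rat set"
  where "Z_loc p = {of_int a / of_int b | a b. b \<noteq> 0 \<and> coprime b (int p)}"

text \<open>The product \<open>\<int>\<^sub>(\<^sub>p\<^sub>) \<cdot> L\<close> consists of all finite sums of products \<open>r \<cdot> x\<close>.\<close>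

definition localization :: "(rat, 'a, 'm) module_scheme \<Rightarrow> nat \<Rightarrow> 'a set \<Rightarrow> 'a set"
  where "localization A p L =
    generate (add_monoid A) {r \<odot>\<^bsub>A\<^esub> x | r x. r \<in> Z_loc p \<and> x \<in> L}"

definition differing_primes :: "(rat, 'a, 'm) module_scheme \<Rightarrow> 'a set \<Rightarrow> 'a set \<Rightarrow> nat set"
  where "differing_primes A \<Lambda> L =
    {p. Factorial_Ring.prime p \<and> localization A p \<Lambda> \<noteq> localization A p L}"

abbreviation sub_ring :: "(rat, 'a, 'm) module_scheme \<Rightarrow> 'a set \<Rightarrow> (rat, 'a, 'm) module_scheme"
  where "sub_ring A \<Lambda> \<equiv> A\<lparr>carrier := \<Lambda>\<rparr>"

abbreviation loc_ring :: "(rat, 'a, 'm) module_scheme \<Rightarrow> 'a set \<Rightarrow> nat \<Rightarrow> (rat, 'a, 'm) module_scheme"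
  where "loc_ring A \<Lambda> p \<equiv> sub_ring A (localization A p \<Lambda>)"

abbreviation loc_quot ::
    "(rat, 'a, 'm) module_scheme \<Rightarrow> 'a set \<Rightarrow> 'a set \<Rightarrow> nat \<Rightarrow> 'a set ring"
  where "loc_quot A \<Lambda> L p \<equiv> loc_ring A \<Lambda> p Quot localization A p L"

definition product_ring :: "'i set \<Rightarrow> ('i \<Rightarrow> ('b, 'c) ring_scheme) \<Rightarrow> ('i \<Rightarrow> 'b) ring"
  where "product_ring I R =
    \<lparr>carrier = (\<Pi>\<^sub>E i\<in>I. carrier (R i)),
     monoid.mult = (\<lambda>x y. \<lambda>i\<in>I. x i \<otimes>\<^bsub>R i\<^esub> y i),
     one = (\<lambda>i\<in>I. \<one>\<^bsub>R i\<^esub>),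
     ring.zero = (\<lambda>i\<in>I. \<zero>\<^bsub>R i\<^esub>),
     ring.add = (\<lambda>x y. \<lambda>i\<in>I. x i \<oplus>\<^bsub>R i\<^esub> y i)\<rparr>"

text \<open>The map \<open>a + L \<mapsto> (a + L\<^sub>(\<^sub>p\<^sub>))\<^sub>p\<close>, given on a coset \<open>C\<close> without choosing a representative:
  the component at \<open>p\<close> is the union of the cosets \<open>a + L\<^sub>(\<^sub>p\<^sub>)\<close> over all \<open>a \<in> C\<close>, which all
  coincide if \<open>C\<close> is a coset of \<open>L\<close>.\<close>

definition natural_map ::
    "(rat, 'a, 'm) module_scheme \<Rightarrow> 'a set \<Rightarrow> nat set \<Rightarrow> 'a set \<Rightarrow> (nat \<Rightarrow> 'a set)"
  where "natural_map A L P C = (\<lambda>p\<in>P. \<Union>a\<in>C. localization A p L +>\<^bsub>A\<^esub> a)"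

end

theory Submission
  imports Defs
begin

text \<open>
  Because \<open>L\<close> spans the algebra over \<open>\<rat>\<close> and \<open>\<Lambda>\<close> is finitely generated, some integer \<open>n > 0\<close> satisfies
  \<open>n \<cdot> \<Lambda> \<subseteq> L\<close>.  Everything rests on this exponent.  It makes \<open>\<Lambda>/L\<close> finite, and it confines the
  primes at which \<open>\<Lambda>\<close> and \<open>L\<close> differ to the divisors of \<open>n\<close>.  A localization at \<open>p\<close> is handled through
  the description \<open>L\<^sub>(\<^sub>p\<^sub>) = {x. m \<cdot> x \<in> L for some integer m prime to p}\<close> (\<open>localization_eq\<close>).

  Part (a) is the Chinese remainder theorem, carried out with integer multipliers.  Write
  \<open>n = p\<^sup>k n'\<close> with \<open>n'\<close> prime to \<open>p\<close>; then \<open>p\<^sup>k\<close> maps \<open>\<Lambda>\<^sub>(\<^sub>p\<^sub>)\<close> into \<open>L\<^sub>(\<^sub>p\<^sub>)\<close>.  Bezout relations between \<open>p\<^sup>k\<close>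
  and integers prime to \<open>p\<close> show that \<open>\<Lambda>\<close> meets every coset of \<open>L\<^sub>(\<^sub>p\<^sub>)\<close> in \<open>\<Lambda>\<^sub>(\<^sub>p\<^sub>)\<close>
  (\<open>localization_representative\<close>) and give an integer that acts as \<open>1\<close> modulo \<open>L\<^sub>(\<^sub>p\<^sub>)\<close> and as \<open>0\<close>
  modulo every other \<open>L\<^sub>(\<^sub>q\<^sub>)\<close> (\<open>local_projector\<close>).  Hence the natural map is onto.  It is injective
  since an element of \<open>\<Lambda>\<close> that lies in all \<open>L\<^sub>(\<^sub>p\<^sub>)\<close> lies in \<open>L\<close>: the integers multiplying it into \<open>L\<close>
  form an ideal of \<open>\<int>\<close> contained in no maximal ideal (\<open>mem_ideal_if_locally\<close>).  The statement on units
  follows because the units of a product of rings are the tuples of units.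

  In part (b), the isomorphism of (a) provides some \<open>a \<in> \<Lambda>\<close> with the required residues, which is a
  unit modulo \<open>L\<close>, but not necessarily a unit of \<open>\<Lambda>\<^sub>(\<^sub>p\<^sub>)\<close>, since \<open>L\<^sub>(\<^sub>p\<^sub>)\<close> need not lie in the Jacobson radical
  of \<open>\<Lambda>\<^sub>(\<^sub>p\<^sub>)\<close>.  To change \<open>a\<close> inside \<open>a + L\<close>, consider the surjection of finite rings
  \<open>\<Lambda>/pL \<rightarrow> \<Lambda>/L\<close>.  Units lift along homomorphisms out of a finite commutative ring: if \<open>e = a\<^sup>N\<close> is
  idempotent, then \<open>a e + (1 - e)\<close> is a unit with the same image as \<open>a\<close> (\<open>finite_imp_unit_lifts\<close>).
  So some \<open>u \<in> a + L\<close> is a unit modulo \<open>pL\<close>, hence modulo \<open>p\<Lambda>\<close>, and an elementary form of Nakayama's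
  lemma (\<open>nakayama_generators\<close>) shows that \<open>u\<close> is a unit of \<open>\<Lambda>\<^sub>(\<^sub>p\<^sub>)\<close>.
\<close>

section \<open>Units of finite commutative rings\<close>

text \<open>The powers of \<open>a\<close> are eventually periodic, say with period \<open>d\<close> from the exponent \<open>i\<close> on.  A multiple \<open>N\<close>
of \<open>d\<close> beyond \<open>i\<close> is the exponent of an idempotent, because \<open>2 N\<close> and \<open>N\<close> differ by a multiple of \<open>d\<close>.\<close>

lemma (in monoid) finite_imp_idempotent_power:
  assumes "finite (carrier G)" and a: "a \<in> carrier G"
  obtains N :: nat where "N > 0" and "a [^] N \<otimes> a [^] N = a [^] N"
proof -
  have "range (\<lambda>i::nat. a [^] i) \<subseteq> carrier G"
    using a by auto
  then have "finite (range (\<lambda>i::nat. a [^] i))"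
    using assms(1) finite_subset by blast
  then have "\<not> inj (\<lambda>i::nat. a [^] i)"
    using finite_imageD infinite_UNIV_nat by blast
  then obtain i j :: nat where "i < j" and eq: "a [^] i = a [^] j"
    unfolding inj_def by (metis linorder_neqE_nat)
  define d where "d = j - i"
  have d: "d > 0" "j = i + d"
    using \<open>i < j\<close> by (auto simp: d_def)
  have shift: "a [^] (m + d) = a [^] m" if "m \<ge> i" for m
  proof -
    have "a [^] (m + d) = a [^] (m - i) \<otimes> a [^] j"
      using that d a by (simp add: nat_pow_mult)
    also have "\<dots> = a [^] m"
      using that a by (simp flip: eq add: nat_pow_mult)
    finally show ?thesis .
  qed
  have shifts: "a [^] (m + d * k) = a [^] m" if "m \<ge> i" for m k
  proof (induction k)
    case (Suc k)
    have "a [^] (m + d * Suc k) = a [^] (m + d * k + d)"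
      by (simp add: algebra_simps)
    then show ?case
      using Suc shift[of "m + d * k"] that by simp
  qed simp
  let ?N = "d * Suc i"
  have "?N \<ge> i"
    using d(1) by (cases d) auto
  then have "a [^] ?N \<otimes> a [^] ?N = a [^] ?N"
    using shifts[of ?N "Suc i"] a by (simp add: nat_pow_mult)
  then show ?thesis
    using that[of ?N] d(1) by simp
qed

text \<open>An idempotent power \<open>e\<close> of \<open>a\<close> splits \<open>R\<close> into \<open>R e\<close>, where \<open>a\<close> is invertible, and \<open>R (1 - e)\<close>, where \<open>a\<close> is
nilpotent.  As \<open>h e\<close> is both idempotent and a unit, \<open>h e = 1\<close>; so replacing the component of \<open>a\<close> in
\<open>R (1 - e)\<close> by \<open>1 - e\<close> changes nothing under \<open>h\<close>.\<close>

lemma (in ring_hom_cring) finite_imp_unit_lifts: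
  assumes fin: "finite (carrier R)" and a: "a \<in> carrier R" and unit: "h a \<in> Units S"
  shows "\<exists>u\<in>Units R. h u = h a"
proof -
  obtain N :: nat where N: "N > 0" and idem: "a [^] N \<otimes> a [^] N = a [^] N"
    using R.finite_imp_idempotent_power[OF fin a] by blast
  define e where "e = a [^] N"
  define b where "b = a [^] (N - 1)"
  have carr: "e \<in> carrier R" "b \<in> carrier R"
    using a by (auto simp: e_def b_def)
  have ab: "a \<otimes> b = e"
    using a N by (cases N) (auto simp: e_def b_def R.m_comm)
  have ee: "e \<otimes> e = e"
    using idem by (simp add: e_def)
  have he: "h e = \<one>\<^bsub>S\<^esub>"
  proof -
    have "h e = h a [^]\<^bsub>S\<^esub> N"
      using a by (simp add: e_def hom_nat_pow)
    then have "h e \<in> Units S"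
      using unit S.Units_pow_closed by simp
    moreover have "h e \<otimes>\<^bsub>S\<^esub> h e = h e \<otimes>\<^bsub>S\<^esub> \<one>\<^bsub>S\<^esub>"
      using carr ee hom_mult[of e e] by simp
    ultimately show ?thesis
      using S.Units_l_cancel carr by blast
  qed
  define u where "u = a \<otimes> e \<oplus> (\<one> \<ominus> e)"
  \<comment> \<open>the inverse of \<open>a\<close> on the component \<open>R e\<close> is \<open>b e\<close>\<close>
  define v where "v = b \<otimes> e \<oplus> (\<one> \<ominus> e)"
  have uv: "u \<in> carrier R" "v \<in> carrier R"
    using a carr by (auto simp: u_def v_def)
  have "u \<otimes> v = (a \<otimes> b) \<otimes> (e \<otimes> e) \<oplus> (a \<oplus> b) \<otimes> (e \<ominus> e \<otimes> e) \<oplus> (\<one> \<ominus> e \<ominus> e \<oplus> e \<otimes> e)"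
    unfolding u_def v_def using a carr by algebra
  also have "\<dots> = e \<oplus> (a \<oplus> b) \<otimes> \<zero> \<oplus> (\<one> \<ominus> e \<ominus> e \<oplus> e)"
    using carr by (simp add: ab ee R.r_neg R.minus_eq)
  also have "\<dots> = \<one>"
    using a carr by algebra
  finally have "u \<otimes> v = \<one>" .
  moreover from this have "v \<otimes> u = \<one>"
    using uv by (simp add: R.m_comm)
  ultimately have "u \<in> Units R"
    using uv unfolding Units_def by blast
  moreover have "h u = h a"
    using a carr by (simp add: u_def he R.minus_eq S.r_neg)
  ultimately show ?thesis
    by blast
qed

section \<open>Products of commutative rings\<close>

lemma product_ring_sel [simp]:
  "carrier (product_ring I R) = (\<Pi>\<^sub>E i\<in>I. carrier (R i))"
  "x \<otimes>\<^bsub>product_ring I R\<^esub> y = (\<lambda>i\<in>I. x i \<otimes>\<^bsub>R i\<^esub> y i)"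
  "\<one>\<^bsub>product_ring I R\<^esub> = (\<lambda>i\<in>I. \<one>\<^bsub>R i\<^esub>)"
  "\<zero>\<^bsub>product_ring I R\<^esub> = (\<lambda>i\<in>I. \<zero>\<^bsub>R i\<^esub>)"
  "x \<oplus>\<^bsub>product_ring I R\<^esub> y = (\<lambda>i\<in>I. x i \<oplus>\<^bsub>R i\<^esub> y i)"
  by (simp_all add: product_ring_def)

lemma cring_product_ring:
  assumes R: "\<And>i. i \<in> I \<Longrightarrow> cring (R i)"
  shows "cring (product_ring I R)"
proof -
  let ?P = "product_ring I R"
  note ring = R[THEN cring.axioms(1)]
  note ag = ring[THEN ring.is_abelian_group]
  note am = ag[THEN abelian_group.axioms(1)]
  note mon = ring[THEN ring.is_monoid]
  have mem: "x i \<in> carrier (R i)" if "x \<in> carrier ?P" "i \<in> I" for x i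
    using that by (auto simp: PiE_iff)
  have restr: "(\<lambda>i\<in>I. x i) = x" if "x \<in> carrier ?P" for x
    using that by (simp add: PiE_restrict)
  show ?thesis
  proof (rule cringI)
    show "abelian_group ?P"
    proof (rule abelian_groupI)
      fix x assume x: "x \<in> carrier ?P"
      have "(\<lambda>i\<in>I. \<ominus>\<^bsub>R i\<^esub> x i) \<in> carrier ?P"
        using mem[OF x] abelian_group.a_inv_closed[OF ag] by simp
      moreover have "(\<lambda>i\<in>I. \<ominus>\<^bsub>R i\<^esub> x i) \<oplus>\<^bsub>?P\<^esub> x = \<zero>\<^bsub>?P\<^esub>"
        using mem[OF x] abelian_group.l_neg[OF ag] by (simp cong: restrict_cong)
      ultimately show "\<exists>y\<in>carrier ?P. y \<oplus>\<^bsub>?P\<^esub> x = \<zero>\<^bsub>?P\<^esub>"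
        by blast
    next
      fix x y z assume "x \<in> carrier ?P" "y \<in> carrier ?P" "z \<in> carrier ?P"
      note xyz = this[THEN mem]
      show "x \<oplus>\<^bsub>?P\<^esub> y \<oplus>\<^bsub>?P\<^esub> z = x \<oplus>\<^bsub>?P\<^esub> (y \<oplus>\<^bsub>?P\<^esub> z)"
        using abelian_monoid.a_assoc[OF am xyz] by (simp cong: restrict_cong)
    next
      fix x y assume "x \<in> carrier ?P" "y \<in> carrier ?P"
      note xy = this[THEN mem]
      show "x \<oplus>\<^bsub>?P\<^esub> y = y \<oplus>\<^bsub>?P\<^esub> x"
        using abelian_monoid.a_comm[OF am xy] by (simp cong: restrict_cong)
      show "x \<oplus>\<^bsub>?P\<^esub> y \<in> carrier ?P"
        using abelian_monoid.a_closed[OF am xy] by simp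
    next
      fix x assume x: "x \<in> carrier ?P"
      show "\<zero>\<^bsub>?P\<^esub> \<oplus>\<^bsub>?P\<^esub> x = x"
        using abelian_monoid.l_zero[OF am mem[OF x]] restr[OF x] by (simp cong: restrict_cong)
    next
      show "\<zero>\<^bsub>?P\<^esub> \<in> carrier ?P"
        using abelian_monoid.zero_closed[OF am] by simp
    qed
    show "comm_monoid ?P"
    proof (rule comm_monoidI)
      fix x y z assume "x \<in> carrier ?P" "y \<in> carrier ?P" "z \<in> carrier ?P"
      note xyz = this[THEN mem]
      show "x \<otimes>\<^bsub>?P\<^esub> y \<otimes>\<^bsub>?P\<^esub> z = x \<otimes>\<^bsub>?P\<^esub> (y \<otimes>\<^bsub>?P\<^esub> z)"
        using monoid.m_assoc[OF mon xyz] by (simp cong: restrict_cong)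
    next
      fix x y assume "x \<in> carrier ?P" "y \<in> carrier ?P"
      note xy = this[THEN mem]
      show "x \<otimes>\<^bsub>?P\<^esub> y = y \<otimes>\<^bsub>?P\<^esub> x"
        using comm_monoid.m_comm[OF cring.axioms(2)[OF R] xy] by (simp cong: restrict_cong)
      show "x \<otimes>\<^bsub>?P\<^esub> y \<in> carrier ?P"
        using monoid.m_closed[OF mon xy] by simp
    next
      fix x assume x: "x \<in> carrier ?P"
      show "\<one>\<^bsub>?P\<^esub> \<otimes>\<^bsub>?P\<^esub> x = x"
        using monoid.l_one[OF mon mem[OF x]] restr[OF x] by (simp cong: restrict_cong)
    next
      show "\<one>\<^bsub>?P\<^esub> \<in> carrier ?P"
        using monoid.one_closed[OF mon] by simp
    qed
    fix x y z assume "x \<in> carrier ?P" "y \<in> carrier ?P" "z \<in> carrier ?P"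
    note xyz = this[THEN mem]
    show "(x \<oplus>\<^bsub>?P\<^esub> y) \<otimes>\<^bsub>?P\<^esub> z = x \<otimes>\<^bsub>?P\<^esub> z \<oplus>\<^bsub>?P\<^esub> y \<otimes>\<^bsub>?P\<^esub> z"
      using ring.ring_simprules(13)[OF ring xyz] by (simp cong: restrict_cong)
  qed
qed

lemma Units_product_ring:
  "Units (product_ring I R) = (\<Pi>\<^sub>E i\<in>I. Units (R i))"
proof (intro equalityI subsetI)
  fix x assume "x \<in> Units (product_ring I R)"
  then obtain y where x: "x \<in> carrier (product_ring I R)" and y: "y \<in> carrier (product_ring I R)"
    and xy: "x \<otimes>\<^bsub>product_ring I R\<^esub> y = \<one>\<^bsub>product_ring I R\<^esub>"
      "y \<otimes>\<^bsub>product_ring I R\<^esub> x = \<one>\<^bsub>product_ring I R\<^esub>"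
    by (auto simp: Units_def)
  have "x i \<otimes>\<^bsub>R i\<^esub> y i = \<one>\<^bsub>R i\<^esub> \<and> y i \<otimes>\<^bsub>R i\<^esub> x i = \<one>\<^bsub>R i\<^esub>" if "i \<in> I" for i
    using xy[THEN fun_cong, of i] that by simp
  then have "x i \<in> Units (R i)" if "i \<in> I" for i
    using x y that unfolding Units_def product_ring_sel by (blast dest: PiE_mem)
  then show "x \<in> (\<Pi>\<^sub>E i\<in>I. Units (R i))"
    using x by (auto simp: PiE_iff)
next
  fix x assume x: "x \<in> (\<Pi>\<^sub>E i\<in>I. Units (R i))"
  then have "\<forall>i\<in>I. \<exists>y\<in>carrier (R i). x i \<otimes>\<^bsub>R i\<^esub> y = \<one>\<^bsub>R i\<^esub> \<and> y \<otimes>\<^bsub>R i\<^esub> x i = \<one>\<^bsub>R i\<^esub>"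
    unfolding PiE_iff Units_def by blast
  then obtain y where y: "\<And>i. i \<in> I \<Longrightarrow>
      y i \<in> carrier (R i) \<and> x i \<otimes>\<^bsub>R i\<^esub> y i = \<one>\<^bsub>R i\<^esub> \<and> y i \<otimes>\<^bsub>R i\<^esub> x i = \<one>\<^bsub>R i\<^esub>"
    by metis
  have "x \<in> carrier (product_ring I R)"
    using x by (auto simp: PiE_iff Units_def)
  moreover have "restrict y I \<in> carrier (product_ring I R)"
    using y by auto
  moreover have "x \<otimes>\<^bsub>product_ring I R\<^esub> restrict y I = \<one>\<^bsub>product_ring I R\<^esub>"
    "restrict y I \<otimes>\<^bsub>product_ring I R\<^esub> x = \<one>\<^bsub>product_ring I R\<^esub>"
    using y by (auto simp: fun_eq_iff restrict_def)
  ultimately show "x \<in> Units (product_ring I R)"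
    unfolding Units_def by blast
qed

text \<open>Turns statements on products of unit groups into statements on the ring \<open>product_ring\<close>, whose unit
group is an abelian group by the general theory.\<close>

lemma units_of_product_ring:
  "units_of (product_ring I R) = product_group I (\<lambda>i. units_of (R i))"
  unfolding units_of_def product_group_def Units_product_ring by (simp add: product_ring_def)

lemma ring_hom_imp_Units:
  assumes h: "h \<in> ring_hom R S" and u: "u \<in> Units R"
  shows "h u \<in> Units S"
proof -
  obtain v where u: "u \<in> carrier R" and v: "v \<in> carrier R"
    and uv: "u \<otimes>\<^bsub>R\<^esub> v = \<one>\<^bsub>R\<^esub>" "v \<otimes>\<^bsub>R\<^esub> u = \<one>\<^bsub>R\<^esub>"
    using u by (auto simp: Units_def)
  have "h u \<otimes>\<^bsub>S\<^esub> h v = \<one>\<^bsub>S\<^esub>" "h v \<otimes>\<^bsub>S\<^esub> h u = \<one>\<^bsub>S\<^esub>"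
    using ring_hom_memE(2)[OF h u v] ring_hom_memE(2)[OF h v u] uv ring_hom_memE(4)[OF h]
    by simp_all
  then show ?thesis
    using ring_hom_memE(1)[OF h] u v unfolding Units_def by blast
qed

lemma ring_iso_imp_units_iso:
  assumes h: "h \<in> ring_iso R S" and "ring R" and "ring S"
  shows "h \<in> iso (units_of R) (units_of S)"
proof -
  interpret R: ring R by fact
  interpret S: ring S by fact
  interpret h: ring_hom_ring R S h
    using h by (auto intro!: ring_hom_ringI2 R.ring_axioms S.ring_axioms simp: ring_iso_def)
  have bij: "bij_betw h (carrier R) (carrier S)"
    using h by (simp add: ring_iso_def)
  then have inj: "inj_on h (carrier R)"
    by (simp add: bij_betw_def)
  have fwd: "h x \<in> Units S" if "x \<in> Units R" for x
    using h that by (auto simp: ring_iso_def intro: ring_hom_imp_Units)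
  have bwd: "x \<in> Units R" if x: "x \<in> carrier R" and u: "h x \<in> Units S" for x
  proof -
    obtain z where z: "z \<in> carrier S" "h x \<otimes>\<^bsub>S\<^esub> z = \<one>\<^bsub>S\<^esub>" "z \<otimes>\<^bsub>S\<^esub> h x = \<one>\<^bsub>S\<^esub>"
      using u by (auto simp: Units_def)
    obtain y where y: "y \<in> carrier R" "z = h y"
      using bij z(1) by (auto simp: bij_betw_def)
    have "h (x \<otimes>\<^bsub>R\<^esub> y) = h \<one>\<^bsub>R\<^esub>" "h (y \<otimes>\<^bsub>R\<^esub> x) = h \<one>\<^bsub>R\<^esub>"
      using x y z by auto
    then have "x \<otimes>\<^bsub>R\<^esub> y = \<one>\<^bsub>R\<^esub>" "y \<otimes>\<^bsub>R\<^esub> x = \<one>\<^bsub>R\<^esub>"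
      using x y(1) by (auto intro!: inj_onD[OF inj])
    then show ?thesis
      using x y(1) by (auto simp: Units_def)
  qed
  have "h ` Units R = Units S"
  proof (intro equalityI subsetI)
    fix z assume z: "z \<in> Units S"
    then obtain x where "x \<in> carrier R" "z = h x"
      using bij S.Units_closed by (auto simp: bij_betw_def)
    then show "z \<in> h ` Units R"
      using bwd z by blast
  qed (use fwd in blast)
  moreover have "inj_on h (Units R)"
    using inj R.Units_closed by (auto intro: inj_on_subset)
  moreover have "h (x \<otimes>\<^bsub>R\<^esub> y) = h x \<otimes>\<^bsub>S\<^esub> h y" if "x \<in> Units R" "y \<in> Units R" for x y
    using that R.Units_closed by simp
  ultimately show ?thesis
    using fwd by (simp add: iso_def hom_def bij_betw_def units_of_def)
qed

section \<open>Quotients of subrings\<close>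

text \<open>The coset operation ignores the carrier, so cosets formed in a subring and in the ambient ring agree.\<close>

lemma a_r_coset_carrier_update [simp]: "a_r_coset (A\<lparr>carrier := B\<rparr>) = a_r_coset A"
  by (intro ext) (simp add: a_r_coset_def r_coset_def)

context cring
begin

lemma ideal_in_subringI:
  assumes B: "subring B R" and I: "additive_subgroup I R" "I \<subseteq> B"
    and absorb: "\<And>b x. b \<in> B \<Longrightarrow> x \<in> I \<Longrightarrow> b \<otimes> x \<in> I"
  shows "ideal I (R\<lparr>carrier := B\<rparr>)"
proof (rule idealI)
  interpret I: additive_subgroup I R by (rule I(1))
  have "subgroup B (add_monoid R)"
    using B by (simp add: subring_def)
  then have "subgroup I (add_monoid R\<lparr>carrier := B\<rparr>)"
    using add.subgroup_incl[OF I.a_subgroup _ I(2)] by simp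
  then show "subgroup I (add_monoid (R\<lparr>carrier := B\<rparr>))"
    by simp
  have "B \<subseteq> carrier R"
    using B by (rule subringE(1))
  then show "a \<otimes>\<^bsub>R\<lparr>carrier := B\<rparr>\<^esub> x \<in> I" if "a \<in> I" "x \<in> carrier (R\<lparr>carrier := B\<rparr>)" for a x
    using that absorb[of x a] by (auto simp: m_comm[of a x])
  show "x \<otimes>\<^bsub>R\<lparr>carrier := B\<rparr>\<^esub> a \<in> I" if "a \<in> I" "x \<in> carrier (R\<lparr>carrier := B\<rparr>)" for a x
    using that absorb by simp
qed (rule subring_is_ring[OF B])

lemma subring_imp_cring:
  "subring B R \<Longrightarrow> cring (R\<lparr>carrier := B\<rparr>)"
  using subcring_iff subcringI' subringE(1) by blast

lemma coset_eq_iff: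
  assumes I: "additive_subgroup I R" and ab: "a \<in> carrier R" "b \<in> carrier R"
  shows "I +> a = I +> b \<longleftrightarrow> a \<ominus> b \<in> I"
proof -
  interpret I: abelian_subgroup I R
    using I by (intro abelian_subgroupI3 abelian_group_axioms)
  show ?thesis
  proof
    assume "I +> a = I +> b"
    then have "a \<in> I +> b"
      using I.a_rcos_self[OF ab(1)] by simp
    then show "a \<ominus> b \<in> I"
      using I.a_rcos_module_minus[OF ring_axioms ab(2,1)] by simp
  next
    assume "a \<ominus> b \<in> I"
    then have "a \<in> I +> b"
      using I.a_rcos_module_minus[OF ring_axioms ab(2,1)] by simp
    then show "I +> a = I +> b"
      using a_repr_independence[OF _ ab(2) I.a_subgroup] by simp
  qed
qed

lemma coset_minus_mem:
  assumes I: "additive_subgroup I R" and a: "a \<in> carrier R" and b: "b \<in> I +> a"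
  shows "b \<in> carrier R" and "b \<ominus> a \<in> I"
proof -
  interpret I: additive_subgroup I R by (rule I)
  obtain x where "x \<in> I" "b = x \<oplus> a"
    using b by (auto simp: a_r_coset_def')
  then show "b \<in> carrier R" "b \<ominus> a \<in> I"
    using a by (auto simp: minus_eq a_assoc r_neg)
qed

text \<open>The union over a coset of \<open>I\<close> computes the map \<open>a + I \<mapsto> a + J\<close> without a choice of representatives.\<close>

lemma Union_cosets_eq:
  assumes I: "additive_subgroup I R" and J: "additive_subgroup J R" and "I \<subseteq> J"
    and a: "a \<in> carrier R"
  shows "(\<Union>b\<in>I +> a. J +> b) = J +> a"
proof -
  have "J +> b = J +> a" if "b \<in> I +> a" for b
    using coset_minus_mem[OF I a that] coset_eq_iff[OF J _ a] \<open>I \<subseteq> J\<close> by blast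
  moreover have "a \<in> I +> a"
    using additive_subgroup.zero_closed[OF I] a by (force simp: a_r_coset_def')
  ultimately have "(\<lambda>b. J +> b) ` (I +> a) = {J +> a}"
    by blast
  then show ?thesis
    by simp
qed

context
  fixes B I
  assumes B: "subring B R" and I: "ideal I (R\<lparr>carrier := B\<rparr>)"
begin

lemma carrier_subring_quot: "carrier (R\<lparr>carrier := B\<rparr> Quot I) = (+>) I ` B"
  by (auto simp: FactRing_def A_RCOSETS_def')

lemma mult_subring_quot:
  "a \<in> B \<Longrightarrow> b \<in> B \<Longrightarrow> (I +> a) \<otimes>\<^bsub>R\<lparr>carrier := B\<rparr> Quot I\<^esub> (I +> b) = I +> (a \<otimes> b)"
  using ideal.rcoset_mult_add[OF I] by (simp add: FactRing_def)

lemma add_subring_quot: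
  "a \<in> B \<Longrightarrow> b \<in> B \<Longrightarrow> (I +> a) \<oplus>\<^bsub>R\<lparr>carrier := B\<rparr> Quot I\<^esub> (I +> b) = I +> (a \<oplus> b)"
  using abelian_subgroup.a_rcos_sum[OF ideal.axioms(1)[OF I, THEN abelian_subgroupI3]]
    ring.is_abelian_group[OF subring_is_ring[OF B]] by (simp add: FactRing_def)

lemma one_subring_quot: "\<one>\<^bsub>R\<lparr>carrier := B\<rparr> Quot I\<^esub> = I +> \<one>"
  by (simp add: FactRing_def)

lemma cring_subring_quot: "cring (R\<lparr>carrier := B\<rparr> Quot I)"
  by (rule ideal.quotient_is_cring[OF I subring_imp_cring[OF B]])

end

lemmas subring_quot_simps =
  carrier_subring_quot mult_subring_quot add_subring_quot one_subring_quot

lemma quotient_map_ring_hom: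
  assumes B: "subring B R"
    and I: "additive_subgroup I R" "ideal I (R\<lparr>carrier := B\<rparr>)"
    and J: "additive_subgroup J R" "ideal J (R\<lparr>carrier := B\<rparr>)"
    and "I \<subseteq> J"
  shows "(\<lambda>C. \<Union>b\<in>C. J +> b) \<in> ring_hom (R\<lparr>carrier := B\<rparr> Quot I) (R\<lparr>carrier := B\<rparr> Quot J)"
proof -
  note sub = subringE(3,6,7)[OF B]
  have carr: "a \<in> carrier R" if "a \<in> B" for a
    using that subringE(1)[OF B] by blast
  have U: "(\<Union>b\<in>I +> a. J +> b) = J +> a" if "a \<in> B" for a
    using that by (intro Union_cosets_eq I(1) J(1) \<open>I \<subseteq> J\<close> carr)
  note simps = subring_quot_simps[OF B I(2)] subring_quot_simps[OF B J(2)] U sub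
  show ?thesis
  proof (rule ring_hom_memI)
    fix x y
    assume "x \<in> carrier (R\<lparr>carrier := B\<rparr> Quot I)" "y \<in> carrier (R\<lparr>carrier := B\<rparr> Quot I)"
    then obtain a b where "a \<in> B" "x = I +> a" "b \<in> B" "y = I +> b"
      by (auto simp: simps(1))
    then show "(\<Union>b\<in>x \<otimes>\<^bsub>R\<lparr>carrier := B\<rparr> Quot I\<^esub> y. J +> b)
        = (\<Union>b\<in>x. J +> b) \<otimes>\<^bsub>R\<lparr>carrier := B\<rparr> Quot J\<^esub> (\<Union>b\<in>y. J +> b)"
      "(\<Union>b\<in>x \<oplus>\<^bsub>R\<lparr>carrier := B\<rparr> Quot I\<^esub> y. J +> b)
        = (\<Union>b\<in>x. J +> b) \<oplus>\<^bsub>R\<lparr>carrier := B\<rparr> Quot J\<^esub> (\<Union>b\<in>y. J +> b)"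
      by (simp_all add: simps del: UN_simps)
  next
    fix x assume "x \<in> carrier (R\<lparr>carrier := B\<rparr> Quot I)"
    then obtain a where "a \<in> B" "x = I +> a"
      by (auto simp: simps(1))
    then show "(\<Union>b\<in>x. J +> b) \<in> carrier (R\<lparr>carrier := B\<rparr> Quot J)"
      by (simp add: simps)
  qed (simp add: simps)
qed

end

section \<open>Lattices in commutative rational algebras\<close>

lemma coprime_bezout:
  fixes a b :: int
  assumes "coprime a b"
  shows "\<exists>u v. u * a + v * b = 1"
  using bezout_int[of a b] coprime_imp_gcd_eq_1[OF assms] by simp

locale rat_algebra = cring A for A :: "(rat, 'a, 'm) module_scheme" (structure) +
  assumes is_algebra: "algebra rat_ring A"
begin

lemma smult_closed [simp, intro]: "x \<in> carrier A \<Longrightarrow> r \<odot> x \<in> carrier A"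
  and smult_add_left: "x \<in> carrier A \<Longrightarrow> (r + s) \<odot> x = r \<odot> x \<oplus> s \<odot> x"
  and smult_add_right: "x \<in> carrier A \<Longrightarrow> y \<in> carrier A \<Longrightarrow> r \<odot> (x \<oplus> y) = r \<odot> x \<oplus> r \<odot> y"
  and smult_smult: "x \<in> carrier A \<Longrightarrow> r \<odot> (s \<odot> x) = (r * s) \<odot> x"
  and smult_one [simp]: "x \<in> carrier A \<Longrightarrow> 1 \<odot> x = x"
  and smult_zero_left [simp]: "x \<in> carrier A \<Longrightarrow> 0 \<odot> x = \<zero>"
  and smult_zero_right [simp]: "r \<odot> \<zero> = \<zero>"
  and smult_mult_left: "x \<in> carrier A \<Longrightarrow> y \<in> carrier A \<Longrightarrow> (r \<odot> x) \<otimes> y = r \<odot> (x \<otimes> y)"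
proof -
  interpret alg: algebra rat_ring A
    by (rule is_algebra)
  show "x \<in> carrier A \<Longrightarrow> r \<odot> x \<in> carrier A"
    "x \<in> carrier A \<Longrightarrow> (r + s) \<odot> x = r \<odot> x \<oplus> s \<odot> x"
    "x \<in> carrier A \<Longrightarrow> y \<in> carrier A \<Longrightarrow> r \<odot> (x \<oplus> y) = r \<odot> x \<oplus> r \<odot> y"
    "x \<in> carrier A \<Longrightarrow> r \<odot> (s \<odot> x) = (r * s) \<odot> x"
    "x \<in> carrier A \<Longrightarrow> 1 \<odot> x = x"
    "x \<in> carrier A \<Longrightarrow> 0 \<odot> x = \<zero>"
    "r \<odot> \<zero> = \<zero>"
    "x \<in> carrier A \<Longrightarrow> y \<in> carrier A \<Longrightarrow> (r \<odot> x) \<otimes> y = r \<odot> (x \<otimes> y)"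
    using alg.smult_closed[of r x] alg.smult_l_distr[of r s x] alg.smult_r_distr[of r x y]
      alg.smult_assoc1[of r s x] alg.smult_one[of x] alg.smult_l_null[of x] alg.smult_r_null[of r]
      alg.smult_assoc2[of r x y]
    by (simp_all add: rat_ring_def)
qed

lemma smult_mult_right: "x \<in> carrier A \<Longrightarrow> y \<in> carrier A \<Longrightarrow> x \<otimes> (r \<odot> y) = r \<odot> (x \<otimes> y)"
  using smult_mult_left[of y x r] by (simp add: m_comm)

lemma smult_uminus: "x \<in> carrier A \<Longrightarrow> (- r) \<odot> x = \<ominus> (r \<odot> x)"
  using smult_add_left[of x "- r" r] by (simp add: sum_zero_eq_neg)

lemma smult_neg: "x \<in> carrier A \<Longrightarrow> r \<odot> (\<ominus> x) = \<ominus> (r \<odot> x)"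
  using smult_add_right[of "\<ominus> x" x r] by (simp add: sum_zero_eq_neg l_neg)

lemma smult_minus_right:
  "x \<in> carrier A \<Longrightarrow> y \<in> carrier A \<Longrightarrow> r \<odot> (x \<ominus> y) = r \<odot> x \<ominus> r \<odot> y"
  by (simp add: minus_eq smult_add_right smult_neg)

lemma smult_minus_left: "x \<in> carrier A \<Longrightarrow> (r - s) \<odot> x = r \<odot> x \<ominus> s \<odot> x"
  using smult_add_left[of x r "- s"] by (simp add: minus_eq smult_uminus)

lemma of_int_smult_smult:
  "x \<in> carrier A \<Longrightarrow> of_int a \<odot> (of_int b \<odot> x) = of_int (a * b) \<odot> x"
  by (simp add: smult_smult)

lemma bezout_smult:
  assumes "u * a + v * b = 1" and x: "x \<in> carrier A"
  shows "of_int (v * b) \<odot> x \<ominus> x = of_int (- u) \<odot> (of_int a \<odot> x)"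
proof -
  have "v * b - 1 = - u * a"
    using assms(1) by simp
  then have "rat_of_int (v * b - 1) = of_int (- u * a)"
    by (rule arg_cong)
  then have "rat_of_int (v * b) - 1 = of_int (- u) * of_int a"
    by (simp only: of_int_diff of_int_mult of_int_1)
  then show ?thesis
    using smult_minus_left[OF x, of "of_int (v * b)" 1] x by (simp only: smult_smult smult_one)
qed

lemma additive_subgroup_memI:
  assumes "H \<subseteq> carrier A" "\<zero> \<in> H" "\<And>x. x \<in> H \<Longrightarrow> \<ominus> x \<in> H"
    "\<And>x y. x \<in> H \<Longrightarrow> y \<in> H \<Longrightarrow> x \<oplus> y \<in> H"
  shows "additive_subgroup H A"
  using assms by (intro additive_subgroupI add.subgroupI) auto

lemma additive_subgroup_minus:
  assumes "additive_subgroup H A" "x \<in> H" "y \<in> H"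
  shows "x \<ominus> y \<in> H"
  using assms by (simp add: minus_eq additive_subgroup.a_closed additive_subgroup.a_inv_closed)

lemma minus_telescope:
  assumes "x \<in> carrier A" "y \<in> carrier A" "z \<in> carrier A" "w \<in> carrier A"
  shows "(x \<ominus> (y \<oplus> z)) \<oplus> (z \<ominus> w) = x \<ominus> (y \<oplus> w)"
proof -
  have "\<ominus> z \<oplus> (z \<oplus> \<ominus> w) = \<ominus> w"
    using assms by (simp add: r_neg1)
  then show ?thesis
    using assms by (simp add: minus_eq minus_add a_assoc)
qed

lemma int_smult_closed:
  assumes H: "additive_subgroup H A" and x: "x \<in> H"
  shows "of_int m \<odot> x \<in> H"
proof -
  interpret H: additive_subgroup H A by (rule H)
  have nat: "of_nat k \<odot> x \<in> H" for k :: nat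
    using x by (induction k) (auto simp: smult_add_left)
  show ?thesis
  proof (cases "m \<ge> 0")
    case True
    then show ?thesis
      using nat[of "nat m"] by simp
  next
    case False
    then have "rat_of_int m = - of_nat (nat (- m))"
      by simp
    then show ?thesis
      using nat[of "nat (- m)"] x by (metis H.a_Hcarr H.a_inv_closed smult_uminus)
  qed
qed

lemma generate_additive_subgroup:
  "F \<subseteq> carrier A \<Longrightarrow> additive_subgroup (generate (add_monoid A) F) A"
  by (simp add: additive_subgroupI add.generate_is_subgroup)

lemma generate_least:
  "F \<subseteq> H \<Longrightarrow> additive_subgroup H A \<Longrightarrow> generate (add_monoid A) F \<subseteq> H"
  by (simp add: add.generate_subgroup_incl additive_subgroup.a_subgroup)

text \<open>Lattices are given as subgroups generated by finite sets.  Splitting off one generator makes induction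
on the set of generators available.\<close>

lemma generate_insert_elem:
  assumes f: "f \<in> carrier A" and F: "F \<subseteq> carrier A"
    and x: "x \<in> generate (add_monoid A) (insert f F)"
  obtains y c where "y \<in> generate (add_monoid A) F" and "x = y \<oplus> of_int c \<odot> f"
proof -
  let ?G = "generate (add_monoid A) F"
  let ?H = "{y \<oplus> of_int c \<odot> f | y c. y \<in> ?G}"
  interpret G: additive_subgroup ?G A
    by (rule generate_additive_subgroup[OF F])
  note [simp] = f G.a_Hcarr
  have "additive_subgroup ?H A"
  proof (rule additive_subgroup_memI)
    show "\<zero> \<in> ?H"
      using G.zero_closed by (auto intro!: exI[of _ "\<zero>"] exI[of _ 0])
    fix x assume "x \<in> ?H"
    then obtain y c where x: "y \<in> ?G" "x = y \<oplus> of_int c \<odot> f"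
      by blast
    then have "\<ominus> x = \<ominus> y \<oplus> of_int (- c) \<odot> f"
      by (simp add: minus_add smult_uminus)
    then show "\<ominus> x \<in> ?H"
      using G.a_inv_closed[OF x(1)] by blast
    fix x' assume "x' \<in> ?H"
    then obtain y' c' where x': "y' \<in> ?G" "x' = y' \<oplus> of_int c' \<odot> f"
      by blast
    then have "x \<oplus> x' = (y \<oplus> y') \<oplus> of_int (c + c') \<odot> f"
      using x by (simp add: smult_add_left a_ac)
    then show "x \<oplus> x' \<in> ?H"
      using G.a_closed[OF x(1) x'(1)] by blast
  qed auto
  moreover have "insert f F \<subseteq> ?H"
  proof -
    have "f = \<zero> \<oplus> of_int 1 \<odot> f" "\<And>g. g \<in> carrier A \<Longrightarrow> g = g \<oplus> of_int 0 \<odot> f"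
      by simp_all
    then show ?thesis
      using G.zero_closed F by (blast intro: generate.incl)
  qed
  ultimately have "x \<in> ?H"
    using x generate_least by blast
  then show ?thesis
    using that by blast
qed

text \<open>A set of representatives consists of the combinations of the generators with coefficients in
\<open>{0..<n}\<close>, since multiples of \<open>n\<close> can be discarded from every coefficient modulo \<open>K\<close>.\<close>

lemma finite_index_lattice:
  assumes "finite F" and "F \<subseteq> carrier A" and K: "additive_subgroup K A" and "n > 0"
    and "\<And>f. f \<in> F \<Longrightarrow> of_int n \<odot> f \<in> K"
  shows "\<exists>T. finite T \<and> T \<subseteq> generate (add_monoid A) F \<and>
    (\<forall>x\<in>generate (add_monoid A) F. \<exists>t\<in>T. x \<ominus> t \<in> K)"
  using assms(1,2,5)
proof (induction F)
  case empty
  have "generate (add_monoid A) {} = {\<zero>}"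
    using add.generate_empty by simp
  then show ?case
    using additive_subgroup.zero_closed[OF K]
    by (intro exI[of _ "{\<zero>}"]) (simp add: minus_eq)
next
  case (insert f F)
  let ?G = "generate (add_monoid A) F" and ?G' = "generate (add_monoid A) (insert f F)"
  obtain T where T: "finite T" "T \<subseteq> ?G" "\<forall>x\<in>?G. \<exists>t\<in>T. x \<ominus> t \<in> K"
    using insert by auto
  interpret K: additive_subgroup K A by (rule K)
  interpret G: additive_subgroup ?G A
    using insert by (intro generate_additive_subgroup) auto
  interpret G': additive_subgroup ?G' A
    using insert by (intro generate_additive_subgroup) auto
  have f: "f \<in> carrier A" "f \<in> ?G'"
    using insert by (auto intro: generate.incl)
  have GG': "?G \<subseteq> ?G'"
    by (intro add.mono_generate) auto
  let ?T = "(\<lambda>(t, c). t \<oplus> of_int c \<odot> f) ` (T \<times> {0..<n})"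
  have "\<exists>t\<in>?T. x \<ominus> t \<in> K" if x: "x \<in> ?G'" for x
  proof -
    obtain y c where y: "y \<in> ?G" "x = y \<oplus> of_int c \<odot> f"
      using generate_insert_elem[OF f(1) _ x] insert by auto
    obtain t where t: "t \<in> T" "y \<ominus> t \<in> K"
      using T(3) y(1) by blast
    have carr: "y \<in> carrier A" "t \<in> carrier A"
      using y t T(2) G.a_Hcarr by auto
    have "rat_of_int c = of_int (c mod n) + of_int (c div n) * of_int n"
      by (metis mod_mult_div_eq of_int_add of_int_mult mult.commute)
    then have "of_int c \<odot> f = of_int (c mod n) \<odot> f \<oplus> of_int (c div n) \<odot> (of_int n \<odot> f)"
      using f(1) by (simp add: smult_add_left smult_smult)
    then have "x \<ominus> (t \<oplus> of_int (c mod n) \<odot> f) = (y \<ominus> t) \<oplus> of_int (c div n) \<odot> (of_int n \<odot> f)"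
      using f(1) carr by (simp add: y(2) minus_eq minus_add a_ac r_neg r_neg1 r_neg2)
    also have "\<dots> \<in> K"
      using t(2) insert.prems(2) int_smult_closed[OF K] by blast
    finally have "x \<ominus> (t \<oplus> of_int (c mod n) \<odot> f) \<in> K" .
    moreover have "t \<oplus> of_int (c mod n) \<odot> f \<in> ?T"
      using t(1) \<open>n > 0\<close> by (intro image_eqI[of _ _ "(t, c mod n)"]) auto
    ultimately show ?thesis
      by blast
  qed
  moreover have "?T \<subseteq> ?G'"
    using T(2) GG' f(2) int_smult_closed[OF G'.additive_subgroup_axioms] by auto
  ultimately show ?case
    using T(1) by (intro exI[of _ ?T]) auto
qed

lemma additive_subgroup_int_multiple:
  assumes H: "additive_subgroup H A"
  shows "additive_subgroup {x \<in> carrier A. of_int n \<odot> x \<in> H} A"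
proof -
  interpret H: additive_subgroup H A by (rule H)
  show ?thesis
    by (rule additive_subgroup_memI) (auto simp: smult_add_right smult_neg)
qed

text \<open>The elements with a positive multiple in \<open>L\<close> form a \<open>\<rat>\<close>-subspace containing \<open>L\<close>, and \<open>L\<close> spans \<open>A\<close>.\<close>

lemma full_lattice_absorbs:
  assumes L: "additive_subgroup L A" and span: "rat_span A L = carrier A" and x: "x \<in> carrier A"
  shows "\<exists>n>0. of_int n \<odot> x \<in> L"
proof -
  interpret L: additive_subgroup L A by (rule L)
  interpret alg: algebra rat_ring A by (rule is_algebra)
  let ?H = "{x \<in> carrier A. \<exists>n>0. of_int n \<odot> x \<in> L}"
  have mult: "of_int (m * n) \<odot> x \<in> L" if "of_int n \<odot> x \<in> L" "x \<in> carrier A" for m n x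
    using int_smult_closed[OF L that(1), of m] that(2) by (simp add: smult_smult)
  have "submodule ?H rat_ring A"
  proof (rule alg.submoduleI)
    show "\<zero> \<in> ?H"
      by (auto intro: exI[of _ 1])
    show "\<ominus> x \<in> ?H" if "x \<in> ?H" for x
      using that by (auto simp: smult_neg)
    show "x \<oplus> y \<in> ?H" if xy: "x \<in> ?H" "y \<in> ?H" for x y
    proof -
      obtain m n where mn: "m > 0" "of_int m \<odot> x \<in> L" "n > 0" "of_int n \<odot> y \<in> L"
        using xy by auto
      then have "of_int (n * m) \<odot> x \<in> L" "of_int (n * m) \<odot> y \<in> L"
        using mult[of m x n] mult[of n y m] xy by (auto simp: mult.commute)
      then have "of_int (n * m) \<odot> (x \<oplus> y) \<in> L"
        using xy by (simp add: smult_add_right)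
      then show ?thesis
        using xy mn by (auto intro!: exI[of _ "n * m"])
    qed
    show "r \<odot> x \<in> ?H" if x: "x \<in> ?H" for r x
    proof -
      obtain n where n: "n > 0" "of_int n \<odot> x \<in> L"
        using x by auto
      obtain a b where r: "r = of_int a / of_int b" "b > 0"
        by (metis quotient_of_div quotient_of_denom_pos surj_pair)
      have "of_int (b * n) \<odot> (r \<odot> x) = of_int (a * n) \<odot> x"
        using r x by (simp add: smult_smult mult.commute)
      then show ?thesis
        using x n r mult by (auto intro!: exI[of _ "b * n"] simp del: of_int_mult)
    qed
  qed auto
  moreover have "L \<subseteq> ?H"
    by (auto intro: exI[of _ 1])
  ultimately have "carrier A \<subseteq> ?H"
    unfolding span[symmetric] rat_span_def by blast
  then show ?thesis
    using x by auto
qed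

lemma full_lattice_absorbs_finitely_generated:
  assumes L: "additive_subgroup L A" and span: "rat_span A L = carrier A"
    and F: "finite F" "F \<subseteq> carrier A"
  shows "\<exists>n>0. \<forall>x\<in>generate (add_monoid A) F. of_int n \<odot> x \<in> L"
proof -
  have "\<exists>n>0. \<forall>x\<in>F. of_int n \<odot> x \<in> L"
    using F
  proof (induction F)
    case empty
    show ?case
      by (auto intro: exI[of _ 1])
  next
    case (insert f F)
    then obtain n m where nm: "n > 0" "\<forall>x\<in>F. of_int n \<odot> x \<in> L" "m > 0" "of_int m \<odot> f \<in> L"
      using full_lattice_absorbs[OF L span, of f] by auto
    have "of_int (n * m) \<odot> x \<in> L" if "x \<in> insert f F" for x
      using that int_smult_closed[OF L nm(4), of n] nm(2) int_smult_closed[OF L, of "of_int n \<odot> x" m] insert.prems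
      by (auto simp: smult_smult mult.commute)
    then show ?case
      using nm by (auto intro!: exI[of _ "n * m"] simp del: of_int_mult)
  qed
  then obtain n where n: "n > 0" "F \<subseteq> {x \<in> carrier A. of_int n \<odot> x \<in> L}"
    using F(2) by blast
  then have "generate (add_monoid A) F \<subseteq> {x \<in> carrier A. of_int n \<odot> x \<in> L}"
    by (intro generate_least additive_subgroup_int_multiple L)
  then show ?thesis
    using n(1) by blast
qed

section \<open>Localization at a prime\<close>

text \<open>A finite sum of elements \<open>(a/b) \<cdot> x\<close> has a common denominator prime to \<open>p\<close>; so no sums are needed, and
membership amounts to a single multiplier.\<close>

lemma localization_eq:
  assumes p: "Factorial_Ring.prime p" and H: "additive_subgroup H A"
  shows "localization A p H = {x \<in> carrier A. \<exists>m. coprime m (int p) \<and> of_int m \<odot> x \<in> H}"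
    (is "_ = ?R")
proof (intro equalityI subsetI)
  interpret H: additive_subgroup H A by (rule H)
  let ?S = "{r \<odot> x | r x. r \<in> Z_loc p \<and> x \<in> H}"
  have mult: "of_int (m * n) \<odot> x \<in> H" if "of_int n \<odot> x \<in> H" "x \<in> carrier A" for m n x
    using int_smult_closed[OF H that(1), of m] that(2) by (simp add: smult_smult)
  have "additive_subgroup ?R A"
  proof (rule additive_subgroup_memI)
    show "\<zero> \<in> ?R"
      by (auto intro: exI[of _ 1])
    show "\<ominus> x \<in> ?R" if "x \<in> ?R" for x
      using that by (auto simp: smult_neg)
    show "x \<oplus> y \<in> ?R" if xy: "x \<in> ?R" "y \<in> ?R" for x y
    proof -
      obtain m n where mn: "coprime m (int p)" "of_int m \<odot> x \<in> H"
          "coprime n (int p)" "of_int n \<odot> y \<in> H"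
        using xy by auto
      then have "of_int (n * m) \<odot> x \<in> H" "of_int (n * m) \<odot> y \<in> H"
        using mult[of m x n] mult[of n y m] xy by (auto simp: mult.commute)
      then have "of_int (n * m) \<odot> (x \<oplus> y) \<in> H"
        using xy by (simp add: smult_add_right)
      then show ?thesis
        using xy mn by (auto intro!: exI[of _ "n * m"])
    qed
  qed auto
  moreover have "?S \<subseteq> ?R"
  proof clarify
    fix r x assume "r \<in> Z_loc p" and x: "x \<in> H"
    then obtain a b where r: "r = of_int a / of_int b" "b \<noteq> 0" "coprime b (int p)"
      by (auto simp: Z_loc_def)
    have "of_int b \<odot> (r \<odot> x) = of_int a \<odot> x"
      using r x by (simp add: smult_smult)
    then have "of_int b \<odot> (r \<odot> x) \<in> H"
      using int_smult_closed[OF H x] by simp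
    then show "r \<odot> x \<in> carrier A \<and> (\<exists>m. coprime m (int p) \<and> of_int m \<odot> (r \<odot> x) \<in> H)"
      using r x by auto
  qed
  ultimately have incl: "localization A p H \<subseteq> ?R"
    unfolding localization_def by (rule generate_least[rotated])
  show "x \<in> ?R" if "x \<in> localization A p H" for x
    using incl that by blast
  show "x \<in> localization A p H" if "x \<in> ?R" for x
  proof -
    obtain m where m: "coprime m (int p)" "of_int m \<odot> x \<in> H" and x: "x \<in> carrier A"
      using \<open>x \<in> ?R\<close> by auto
    have "m \<noteq> 0"
      using m(1) p by (auto simp: prime_nat_iff)
    then have "x = (of_int 1 / of_int m) \<odot> (of_int m \<odot> x)"
      using x by (simp add: smult_smult)
    moreover have "of_int 1 / of_int m \<in> Z_loc p"
      using m(1) \<open>m \<noteq> 0\<close> unfolding Z_loc_def by blast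
    ultimately have "x \<in> ?S"
      using m(2) by blast
    then show ?thesis
      unfolding localization_def by (rule generate.incl)
  qed
qed

lemma additive_subgroup_localization:
  assumes H: "H \<subseteq> carrier A"
  shows "additive_subgroup (localization A p H) A"
  unfolding localization_def using H by (intro generate_additive_subgroup) auto

lemma localization_mono: "H \<subseteq> H' \<Longrightarrow> localization A p H \<subseteq> localization A p H'"
  unfolding localization_def by (intro add.mono_generate) auto

lemma subset_localization:
  assumes "H \<subseteq> carrier A"
  shows "H \<subseteq> localization A p H"
proof
  fix x assume x: "x \<in> H"
  have "1 \<in> Z_loc p"
    unfolding Z_loc_def by (auto intro!: exI[of _ 1])
  then have "1 \<odot> x \<in> localization A p H"
    unfolding localization_def using x by (blast intro: generate.incl)
  then show "x \<in> localization A p H"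
    using x assms by auto
qed

lemma localization_mult:
  assumes p: "Factorial_Ring.prime p" and H: "additive_subgroup H A" and K: "additive_subgroup K A"
    and HK: "\<And>x y. x \<in> H \<Longrightarrow> y \<in> K \<Longrightarrow> x \<otimes> y \<in> K"
    and x: "x \<in> localization A p H" and y: "y \<in> localization A p K"
  shows "x \<otimes> y \<in> localization A p K"
proof -
  obtain m n where mn: "coprime m (int p)" "of_int m \<odot> x \<in> H" "coprime n (int p)" "of_int n \<odot> y \<in> K"
    and xy: "x \<in> carrier A" "y \<in> carrier A"
    using x y by (auto simp: localization_eq[OF p] H K)
  have "of_int (m * n) \<odot> (x \<otimes> y) = (of_int m \<odot> x) \<otimes> (of_int n \<odot> y)"
    using xy by (simp add: smult_mult_left smult_mult_right smult_smult mult.commute)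
  then have "of_int (m * n) \<odot> (x \<otimes> y) \<in> K"
    using HK[OF mn(2,4)] by simp
  then show ?thesis
    using xy mn(1,3) by (auto simp: localization_eq[OF p K] simp del: of_int_mult intro!: exI[of _ "m * n"])
qed

text \<open>Nakayama's lemma over the local ring \<open>\<int>\<^sub>(\<^sub>p\<^sub>)\<close>, with denominators cleared: if \<open>F\<close> is contained in \<open>p\<langle>F\<rangle> + K\<close>, then
one integer prime to \<open>p\<close> multiplies \<open>F\<close> into \<open>K\<close>.  The induction eliminates a generator \<open>f\<close>.  Modulo \<open>K\<close>,
\<open>f\<close> equals \<open>p (l\<^sub>0 + c\<^sub>0 f)\<close> with \<open>l\<^sub>0 \<in> \<langle>F\<rangle>\<close>, so \<open>s f \<equiv> p l\<^sub>0\<close> for \<open>s = 1 - p c\<^sub>0\<close>, which is prime to \<open>p\<close>.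
Multiplying the relation of another generator by \<open>s\<close> removes \<open>f\<close> from it, and the factor \<open>s\<close> on the left is
undone by a Bezout relation \<open>u s + v p = 1\<close>, whose term \<open>v p g\<close> is again in \<open>p\<langle>F\<rangle>\<close>.\<close>

lemma nakayama_generators:
  assumes p: "Factorial_Ring.prime p" and "finite F" and "F \<subseteq> carrier A"
    and K: "additive_subgroup K A"
    and "\<And>f. f \<in> F \<Longrightarrow> \<exists>l\<in>generate (add_monoid A) F. f \<ominus> of_nat p \<odot> l \<in> K"
  shows "\<exists>m. coprime m (int p) \<and> (\<forall>f\<in>F. of_int m \<odot> f \<in> K)"
  using assms(2,3,5)
proof (induction F)
  case empty
  show ?case
    by (auto intro: exI[of _ 1])
next
  case (insert f F)
  let ?G = "generate (add_monoid A) F"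
  have fF: "f \<in> carrier A" "F \<subseteq> carrier A"
    using insert.prems by auto
  interpret K: additive_subgroup K A by (rule K)
  interpret G: additive_subgroup ?G A
    by (rule generate_additive_subgroup[OF fF(2)])
  note Gint = int_smult_closed[OF G.additive_subgroup_axioms]
    and Kint = int_smult_closed[OF K]
  have ex: "\<exists>l c. l \<in> ?G \<and> g \<ominus> of_nat p \<odot> (l \<oplus> of_int c \<odot> f) \<in> K" if "g \<in> insert f F" for g
    using insert.prems(2)[OF that] generate_insert_elem[OF fF] by metis
  obtain l0 c0 where l0: "l0 \<in> ?G" and f_eq: "f \<ominus> of_nat p \<odot> (l0 \<oplus> of_int c0 \<odot> f) \<in> K"
    using ex[of f] by auto
  define s where "s = 1 - int p * c0"
  have cop: "coprime s (int p)"
  proof (rule coprimeI)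
    fix d assume "d dvd s" "d dvd int p"
    then have "d dvd s + int p * c0"
      by (intro dvd_add) auto
    then show "is_unit d"
      by (simp add: s_def)
  qed
  have sf: "of_int s \<odot> f \<ominus> of_nat p \<odot> l0 \<in> K"
  proof -
    have "of_int s \<odot> f \<ominus> of_nat p \<odot> l0 = f \<ominus> of_nat p \<odot> (l0 \<oplus> of_int c0 \<odot> f)"
      using fF l0 by (simp add: s_def smult_minus_left smult_add_right smult_smult minus_eq minus_add a_ac)
    then show ?thesis
      using f_eq by simp
  qed
  obtain u v where uv: "u * s + v * int p = 1"
    using coprime_bezout[OF cop] by blast
  have "\<exists>l\<in>?G. g \<ominus> of_nat p \<odot> l \<in> K" if g: "g \<in> F" for g
  proof -
    obtain l c where l: "l \<in> ?G" and g_eq: "g \<ominus> of_nat p \<odot> (l \<oplus> of_int c \<odot> f) \<in> K"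
      using ex[of g] g by auto
    \<comment> \<open>multiply the relation for \<open>g\<close> by \<open>u s\<close>, use the one for \<open>s f\<close>, and add \<open>v p g\<close>\<close>
    define l' where "l' = of_int u \<odot> (of_int s \<odot> l \<oplus> of_int (c * int p) \<odot> l0) \<oplus> of_int v \<odot> g"
    have gG: "g \<in> ?G"
      using g by (auto intro: generate.incl)
    have l': "l' \<in> ?G"
      unfolding l'_def using gG l l0 by (intro G.a_closed Gint)
    have carr: "g \<in> carrier A" "l \<in> carrier A" "l0 \<in> carrier A"
      using gG l l0 by auto
    let ?kg = "g \<ominus> of_nat p \<odot> (l \<oplus> of_int c \<odot> f)"
    let ?kf = "of_int s \<odot> f \<ominus> of_nat p \<odot> l0"
    have "of_int (u * s) \<odot> ?kg \<oplus> of_int (u * c * int p) \<odot> ?kf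
        = of_int (u * s) \<odot> g \<ominus> of_nat p \<odot> (of_int u \<odot> (of_int s \<odot> l \<oplus> of_int (c * int p) \<odot> l0))"
      using carr fF
        minus_telescope[of "of_int (u * s) \<odot> g" "of_int (u * s * int p) \<odot> l"
          "of_int (u * s * c * int p) \<odot> f" "of_int (u * c * int p * int p) \<odot> l0"]
      by (simp add: smult_minus_right smult_add_right smult_smult mult_ac)
    also have "\<dots> = (of_int (u * s) \<odot> g \<oplus> of_int (v * int p) \<odot> g) \<ominus> of_nat p \<odot> l'"
      unfolding l'_def using carr
      by (simp add: smult_add_right smult_smult mult_ac minus_eq minus_add r_neg1 r_neg2 a_ac)
    also have "of_int (u * s) \<odot> g \<oplus> of_int (v * int p) \<odot> g = g"
    proof -
      have "rat_of_int (u * s) + of_int (v * int p) = 1"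
        using uv by (metis of_int_1 of_int_add)
      then show ?thesis
        using carr smult_add_left[of g "of_int (u * s)" "of_int (v * int p)"] by simp
    qed
    finally have "g \<ominus> of_nat p \<odot> l' \<in> K"
      using g_eq sf Kint by (metis K.a_closed)
    then show ?thesis
      using l' by blast
  qed
  then obtain m where m: "coprime m (int p)" "\<And>g. g \<in> F \<Longrightarrow> of_int m \<odot> g \<in> K"
    using insert.IH fF(2) by blast
  have "?G \<subseteq> {x \<in> carrier A. of_int m \<odot> x \<in> K}"
    using m(2) fF(2) by (intro generate_least additive_subgroup_int_multiple K) auto
  then have "of_int m \<odot> l0 \<in> K"
    using l0 by blast
  then have "of_int m \<odot> (of_int s \<odot> f \<ominus> of_nat p \<odot> l0) \<oplus> of_int (int p) \<odot> (of_int m \<odot> l0) \<in> K"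
    by (rule K.a_closed[OF Kint[OF sf] Kint])
  also have "of_int m \<odot> (of_int s \<odot> f \<ominus> of_nat p \<odot> l0) \<oplus> of_int (int p) \<odot> (of_int m \<odot> l0)
      = of_int (m * s) \<odot> f"
    using fF l0
    by (simp add: smult_add_right smult_neg smult_smult minus_eq a_assoc mult.commute l_neg)
  finally have "of_int (m * s) \<odot> f \<in> K" .
  moreover have "of_int (m * s) \<odot> g \<in> K" if "g \<in> F" for g
    using Kint[OF m(2)[OF that], of s] that fF(2) by (auto simp: smult_smult mult.commute)
  ultimately show ?case
    using m(1) cop by (intro exI[of _ "m * s"]) auto
qed

end

section \<open>An order modulo an ideal\<close>

text \<open>The integer \<open>n\<close> stands for the fact that \<open>L\<close> spans the algebra; the generators \<open>F\<close> serve the finiteness of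
quotients of \<open>\<Lambda>\<close> and Nakayama's lemma.\<close>

locale order_with_ideal = rat_algebra A for A :: "(rat, 'a, 'm) module_scheme" (structure) +
  fixes \<Lambda> L F :: "'a set" and n :: int
  assumes fin_gen: "finite F" "F \<subseteq> carrier A" "\<Lambda> = generate (add_monoid A) F"
    and order_subring: "subring \<Lambda> A"
    and ideal_subgroup: "additive_subgroup L A"
    and ideal_subset: "L \<subseteq> \<Lambda>"
    and ideal_absorb: "\<And>x y. x \<in> \<Lambda> \<Longrightarrow> y \<in> L \<Longrightarrow> x \<otimes> y \<in> L"
    and exponent_pos: "n > 0"
    and exponent: "\<And>x. x \<in> \<Lambda> \<Longrightarrow> of_int n \<odot> x \<in> L"
begin

abbreviation \<Lambda>loc :: "nat \<Rightarrow> 'a set" where "\<Lambda>loc p \<equiv> localization A p \<Lambda>"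
abbreviation Lloc :: "nat \<Rightarrow> 'a set" where "Lloc p \<equiv> localization A p L"

lemma order_subgroup: "additive_subgroup \<Lambda> A"
  using order_subring by (simp add: subring_def additive_subgroup_def)

lemma order_subset: "\<Lambda> \<subseteq> carrier A"
  using order_subring by (rule subringE(1))

lemma order_carrier [simp]: "x \<in> \<Lambda> \<Longrightarrow> x \<in> carrier A"
  using order_subset by blast

lemma Lloc_subgroup: "additive_subgroup (Lloc p) A"
  using ideal_subset order_subset by (intro additive_subgroup_localization) blast

lemma \<Lambda>loc_subgroup: "additive_subgroup (\<Lambda>loc p) A"
  using order_subset by (intro additive_subgroup_localization)

lemmas \<Lambda>_zero = additive_subgroup.zero_closed[OF order_subgroup]
lemmas \<Lambda>_add = additive_subgroup.a_closed[OF order_subgroup]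
lemmas \<Lambda>_uminus = additive_subgroup.a_inv_closed[OF order_subgroup]
lemmas L_add = additive_subgroup.a_closed[OF ideal_subgroup]
lemmas Lloc_zero = additive_subgroup.zero_closed[OF Lloc_subgroup]
lemmas Lloc_add = additive_subgroup.a_closed[OF Lloc_subgroup]

lemmas Lloc_eq = localization_eq[OF _ ideal_subgroup]
lemmas \<Lambda>loc_eq = localization_eq[OF _ order_subgroup]

lemma coprime_multiple_mem_Lloc:
  assumes "Factorial_Ring.prime p" "x \<in> carrier A" "coprime m (int p)" "of_int m \<odot> x \<in> L"
  shows "x \<in> Lloc p"
  using assms by (auto simp: Lloc_eq)

text \<open>\<open>p\<^sup>k\<close> is the full power of \<open>p\<close> in \<open>n\<close>.  Up to the cofactor \<open>n'\<close>, which is invertible at \<open>p\<close>, multiplication by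
\<open>p\<^sup>k\<close> is multiplication by \<open>n\<close>.\<close>

lemma prime_power_absorbs:
  assumes p: "Factorial_Ring.prime p"
  shows "\<exists>n' k. coprime n' (int p) \<and> n = int p ^ k * n' \<and>
    (\<forall>x\<in>\<Lambda>loc p. of_int (int p ^ k) \<odot> x \<in> Lloc p)"
proof -
  have "n \<noteq> 0"
    using exponent_pos by simp
  moreover have pi: "Factorial_Ring.prime (int p)"
    using p by simp
  then have "\<not> is_unit (int p)"
    using not_prime_unit by blast
  ultimately obtain n' where n': "n = int p ^ multiplicity (int p) n * n'" "\<not> int p dvd n'"
    by (rule multiplicity_decompose')
  define k where "k = multiplicity (int p) n"
  have n_eq: "n = int p ^ k * n'"
    unfolding k_def by (rule n'(1))
  have cop: "coprime n' (int p)"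
    using prime_imp_coprime[OF pi n'(2)] by (simp only: coprime_commute)
  have "of_int (int p ^ k) \<odot> x \<in> Lloc p" if "x \<in> \<Lambda>loc p" for x
  proof -
    obtain m where m: "coprime m (int p)" "of_int m \<odot> x \<in> \<Lambda>" and x: "x \<in> carrier A"
      using \<open>x \<in> \<Lambda>loc p\<close> by (auto simp: \<Lambda>loc_eq[OF p])
    have "m * n' * int p ^ k = n * m"
      unfolding n_eq by (simp only: mult_ac)
    then have "of_int (m * n') \<odot> (of_int (int p ^ k) \<odot> x) = of_int n \<odot> (of_int m \<odot> x)"
      by (simp only: of_int_smult_smult[OF x])
    then have "of_int (m * n') \<odot> (of_int (int p ^ k) \<odot> x) \<in> L"
      using exponent[OF m(2)] by simp
    moreover have "coprime (m * n') (int p)"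
      using m(1) cop by simp
    ultimately show ?thesis
      by (rule coprime_multiple_mem_Lloc[OF p smult_closed[OF x], rotated])
  qed
  then show ?thesis
    using cop n_eq by blast
qed

lemma localization_eq_if_not_dvd:
  assumes p: "Factorial_Ring.prime p" and "\<not> int p dvd n"
  shows "\<Lambda>loc p = Lloc p"
proof
  obtain n' k where "coprime n' (int p)" and k: "n = int p ^ k * n'"
    and abs: "\<And>x. x \<in> \<Lambda>loc p \<Longrightarrow> of_int (int p ^ k) \<odot> x \<in> Lloc p"
    using prime_power_absorbs[OF p] by blast
  have "k = 0"
  proof (rule ccontr)
    assume "k \<noteq> 0"
    then have "int p dvd int p ^ k * n'"
      by (intro dvd_mult2 dvd_power) simp
    then show False
      using assms(2) unfolding k by contradiction
  qed
  show "\<Lambda>loc p \<subseteq> Lloc p"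
  proof
    fix x assume x: "x \<in> \<Lambda>loc p"
    have "of_int (int p ^ 0) \<odot> x \<in> Lloc p"
      using abs[OF x] unfolding \<open>k = 0\<close> .
    then show "x \<in> Lloc p"
      using additive_subgroup.a_Hcarr[OF \<Lambda>loc_subgroup x] by simp
  qed
qed (rule localization_mono[OF ideal_subset])

lemma finite_differing_primes: "finite (differing_primes A \<Lambda> L)"
proof -
  have "differing_primes A \<Lambda> L \<subseteq> nat ` {d. d dvd n}"
  proof
    fix p assume "p \<in> differing_primes A \<Lambda> L"
    then have "int p dvd n"
      using localization_eq_if_not_dvd by (auto simp: differing_primes_def)
    then show "p \<in> nat ` {d. d dvd n}"
      by (intro image_eqI[of _ _ "int p"]) auto
  qed
  moreover have "finite {d. d dvd n}"
    using exponent_pos by (intro finite_divisors_int) simp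
  ultimately show ?thesis
    by (rule finite_subset[OF _ finite_imageI])
qed

text \<open>With \<open>n = p\<^sup>k n'\<close> and \<open>u p\<^sup>k + v n' = 1\<close>, the integer \<open>c = v n'\<close> differs from \<open>1\<close> by a multiple of \<open>p\<^sup>k\<close>, while
\<open>p\<^sup>k c\<close> is a multiple of \<open>n\<close> and \<open>p\<^sup>k\<close> is invertible at every other prime.\<close>

lemma local_projector:
  assumes p: "Factorial_Ring.prime p"
  shows "\<exists>c. \<forall>x\<in>\<Lambda>. of_int c \<odot> x \<ominus> x \<in> Lloc p \<and>
    (\<forall>q. Factorial_Ring.prime q \<and> q \<noteq> p \<longrightarrow> of_int c \<odot> x \<in> Lloc q)"
proof -
  obtain n' k where cop: "coprime n' (int p)" and n: "n = int p ^ k * n'"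
    and abs: "\<And>x. x \<in> \<Lambda>loc p \<Longrightarrow> of_int (int p ^ k) \<odot> x \<in> Lloc p"
    using prime_power_absorbs[OF p] by blast
  obtain u v where uv: "u * int p ^ k + v * n' = 1"
  proof -
    have "coprime (int p ^ k) n'"
      using cop by (simp add: coprime_commute[of _ n'])
    then show ?thesis
      using coprime_bezout that by blast
  qed
  show ?thesis
  proof (intro exI[of _ "v * n'"] ballI conjI allI impI)
    fix x assume x: "x \<in> \<Lambda>"
    then have [simp]: "x \<in> carrier A"
      by simp
    have "of_int (- u) \<odot> (of_int (int p ^ k) \<odot> x) \<in> Lloc p"
      using x subset_localization[OF order_subset]
      by (intro int_smult_closed[OF Lloc_subgroup abs]) blast
    then have "of_int (v * n') \<odot> x \<ominus> x \<in> Lloc p"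
      unfolding bezout_smult[OF uv \<open>x \<in> carrier A\<close>] .
    then show "of_int (v * n') \<odot> x \<ominus> x \<in> Lloc p" .
    fix q assume "Factorial_Ring.prime q \<and> q \<noteq> p"
    then have q: "Factorial_Ring.prime q" and "p \<noteq> q"
      by blast+
    then have "coprime (int p) (int q)"
      using primes_coprime[OF p q] by simp
    then have "coprime (int p ^ k) (int q)"
      by (rule coprime_power_left_iff[THEN iffD2, OF disjI1])
    moreover have "int p ^ k * (v * n') = v * n"
      unfolding n by (simp only: mult_ac)
    then have "of_int (int p ^ k) \<odot> (of_int (v * n') \<odot> x) = of_int v \<odot> (of_int n \<odot> x)"
      by (simp only: of_int_smult_smult[OF \<open>x \<in> carrier A\<close>])
    then have "of_int (int p ^ k) \<odot> (of_int (v * n') \<odot> x) \<in> L"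
      using int_smult_closed[OF ideal_subgroup exponent[OF x]] by (simp only:)
    ultimately show "of_int (v * n') \<odot> x \<in> Lloc q"
      by (intro coprime_multiple_mem_Lloc[OF q smult_closed[OF \<open>x \<in> carrier A\<close>]])
  qed
qed

lemma chinese_remainder:
  assumes "finite S" and "\<And>p. p \<in> S \<Longrightarrow> Factorial_Ring.prime p \<and> a p \<in> \<Lambda>"
  shows "\<exists>x\<in>\<Lambda>. (\<forall>p\<in>S. x \<ominus> a p \<in> Lloc p) \<and>
    (\<forall>q. Factorial_Ring.prime q \<and> q \<notin> S \<longrightarrow> x \<in> Lloc q)"
  using assms
proof (induction S)
  case empty
  show ?case
    using Lloc_zero \<Lambda>_zero by (intro bexI[of _ \<zero>]) auto
next
  case (insert p S)
  obtain x where x: "x \<in> \<Lambda>" "\<And>p. p \<in> S \<Longrightarrow> x \<ominus> a p \<in> Lloc p"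
    "\<And>q. Factorial_Ring.prime q \<Longrightarrow> q \<notin> S \<Longrightarrow> x \<in> Lloc q"
    using insert by auto
  have p: "Factorial_Ring.prime p" "a p \<in> \<Lambda>"
    using insert.prems by auto
  obtain c where c: "of_int c \<odot> a p \<ominus> a p \<in> Lloc p"
    "\<And>q. Factorial_Ring.prime q \<Longrightarrow> q \<noteq> p \<Longrightarrow> of_int c \<odot> a p \<in> Lloc q"
    using local_projector[OF p(1)] p(2) by blast
  let ?y = "x \<oplus> of_int c \<odot> a p"
  have carr: "x \<in> carrier A" "a q \<in> carrier A" if "q \<in> insert p S" for q
    using x(1) insert.prems that by auto
  show ?case
  proof (intro bexI[of _ ?y] conjI ballI allI impI)
    show "?y \<in> \<Lambda>"
      using x(1) p(2) int_smult_closed[OF order_subgroup] \<Lambda>_add by blast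
    fix q assume q: "q \<in> insert p S"
    have "x \<oplus> (of_int c \<odot> a p \<ominus> a p) \<in> Lloc p"
      using x(3)[OF p(1)] insert.hyps c(1) Lloc_add by blast
    moreover have "(x \<ominus> a q) \<oplus> of_int c \<odot> a p \<in> Lloc q" if "q \<in> S"
      using that x(2) c(2) insert.prems insert.hyps by (metis Lloc_add insertCI)
    ultimately show "?y \<ominus> a q \<in> Lloc q"
      using q carr[OF q] carr[of p] by (auto simp: minus_eq a_ac)
  next
    fix q assume "Factorial_Ring.prime q \<and> q \<notin> insert p S"
    then show "?y \<in> Lloc q"
      using x(3) c(2) Lloc_add by auto
  qed
qed

text \<open>If \<open>m x \<in> \<Lambda>\<close> and \<open>u m + v p\<^sup>k = 1\<close>, then \<open>u m x \<in> \<Lambda>\<close> differs from \<open>x\<close> by \<open>- v p\<^sup>k x\<close>, an element of \<open>L\<^sub>(\<^sub>p\<^sub>)\<close>.\<close>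

lemma localization_representative:
  assumes p: "Factorial_Ring.prime p" and x: "x \<in> \<Lambda>loc p"
  shows "\<exists>a\<in>\<Lambda>. a \<ominus> x \<in> Lloc p"
proof -
  obtain n' k where "coprime n' (int p)" and "n = int p ^ k * n'"
    and abs: "\<And>x. x \<in> \<Lambda>loc p \<Longrightarrow> of_int (int p ^ k) \<odot> x \<in> Lloc p"
    using prime_power_absorbs[OF p] by blast
  obtain m where m: "coprime m (int p)" "of_int m \<odot> x \<in> \<Lambda>" and [simp]: "x \<in> carrier A"
    using x by (auto simp: \<Lambda>loc_eq[OF p])
  obtain u v where uv: "u * m + v * int p ^ k = 1"
  proof -
    have "coprime m (int p ^ k)"
      using m(1) by simp
    then show ?thesis
      using coprime_bezout that by blast
  qed
  then have "v * int p ^ k + u * m = 1"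
    by (simp only: add.commute)
  then have "of_int u \<odot> (of_int m \<odot> x) \<ominus> x = of_int (- v) \<odot> (of_int (int p ^ k) \<odot> x)"
    using bezout_smult[of v "int p ^ k" u m x] by (simp add: smult_smult)
  moreover have "of_int (- v) \<odot> (of_int (int p ^ k) \<odot> x) \<in> Lloc p"
    by (rule int_smult_closed[OF Lloc_subgroup abs[OF x]])
  ultimately show ?thesis
    using int_smult_closed[OF order_subgroup m(2), of u]
    by (intro bexI[of _ "of_int u \<odot> (of_int m \<odot> x)"]) (simp_all only:)
qed

text \<open>Let \<open>d\<close> be the least positive integer with \<open>d x \<in> L\<close>.  If a prime \<open>p\<close> divided \<open>d\<close>, then the gcd of \<open>d\<close> with a
multiplier prime to \<open>p\<close> would be a smaller one.\<close>

lemma mem_ideal_if_locally: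
  assumes x: "x \<in> \<Lambda>" and loc: "\<And>p. Factorial_Ring.prime p \<Longrightarrow> x \<in> Lloc p"
  shows "x \<in> L"
proof -
  have [simp]: "x \<in> carrier A"
    using x by simp
  let ?P = "\<lambda>d::nat. d > 0 \<and> of_int (int d) \<odot> x \<in> L"
  define d where "d = (LEAST d. ?P d)"
  have "?P (nat n)"
    using exponent[OF x] exponent_pos by simp
  then have d: "d > 0" "of_int (int d) \<odot> x \<in> L"
    unfolding d_def using LeastI[of ?P] by blast+
  have "d = 1"
  proof (rule ccontr)
    assume "d \<noteq> 1"
    then obtain p where p: "Factorial_Ring.prime p" "p dvd d"
      using prime_factor_nat by blast
    obtain m where m: "coprime m (int p)" "of_int m \<odot> x \<in> L"
      using loc[OF p(1)] by (auto simp: Lloc_eq[OF p(1)])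
    obtain u v where uv: "u * m + v * int d = gcd m (int d)"
      using bezout_int by blast
    \<comment> \<open>the gcd is an integer combination of the multipliers \<open>m\<close> and \<open>d\<close>, hence itself one\<close>
    let ?g = "nat (gcd m (int d))"
    have "of_int u \<odot> (of_int m \<odot> x) \<oplus> of_int v \<odot> (of_int (int d) \<odot> x) \<in> L"
      using m(2) d(2) int_smult_closed[OF ideal_subgroup] by (blast intro: L_add)
    also have "of_int u \<odot> (of_int m \<odot> x) \<oplus> of_int v \<odot> (of_int (int d) \<odot> x)
        = of_int (u * m + v * int d) \<odot> x"
      by (simp add: smult_add_left smult_smult)
    also have "\<dots> = of_int (int ?g) \<odot> x"
      unfolding uv by simp
    finally have "?P ?g"
      using d(1) by simp
    then have "d \<le> ?g"
      unfolding d_def by (rule Least_le)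
    moreover have "gcd m (int d) \<le> int d"
      using d(1) by (simp add: zdvd_imp_le)
    moreover have "int d \<le> gcd m (int d) \<longleftrightarrow> d \<le> ?g"
      by (simp add: le_nat_iff)
    ultimately have "gcd m (int d) = int d"
      by (simp only: order_antisym)
    then have "int p dvd m"
      using p(2) by (metis dvd_trans gcd_dvd1 int_dvd_int_iff)
    then have "int p dvd 1"
      using m(1) by (metis coprime_def dvd_refl)
    then show False
      using p(1) by (auto simp: prime_nat_iff)
  qed
  then show ?thesis
    using d(2) by simp
qed

lemma finite_cosets:
  assumes K: "additive_subgroup K A" and "m > 0" and "\<And>x. x \<in> \<Lambda> \<Longrightarrow> of_int m \<odot> x \<in> K"
  shows "finite ((+>) K ` \<Lambda>)"
proof -
  have "\<And>f. f \<in> F \<Longrightarrow> f \<in> \<Lambda>"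
    unfolding fin_gen(3) by (rule generate.incl)
  then obtain T where T: "finite T" "T \<subseteq> \<Lambda>" "\<forall>x\<in>\<Lambda>. \<exists>t\<in>T. x \<ominus> t \<in> K"
    using finite_index_lattice[OF fin_gen(1,2) K assms(2)] assms(3)
    unfolding fin_gen(3)[symmetric] by blast
  have "(+>) K ` \<Lambda> \<subseteq> (+>) K ` T"
  proof clarify
    fix x assume x: "x \<in> \<Lambda>"
    then obtain t where t: "t \<in> T" "x \<ominus> t \<in> K"
      using T(3) by blast
    then have "K +> x = K +> t"
      using coset_eq_iff[OF K] x T(2) by (meson order_carrier subsetD)
    then show "K +> x \<in> (+>) K ` T"
      using t(1) by blast
  qed
  then show ?thesis
    using T(1) finite_surj by blast
qed

text \<open>Nakayama's lemma for the subgroup \<open>u\<Lambda>\<close>: every \<open>f\<close> is \<open>u (c f)\<close> up to an element of \<open>p\<Lambda>\<close>, so \<open>m\<Lambda> \<subseteq> u\<Lambda>\<close> for some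
\<open>m\<close> prime to \<open>p\<close>.  Writing \<open>m \<cdot> 1 = u z\<close>, the inverse of \<open>u\<close> is \<open>z/m\<close>.\<close>

lemma unit_mod_prime_imp_unit_in_localization:
  assumes p: "Factorial_Ring.prime p" and u: "u \<in> \<Lambda>" and c: "c \<in> \<Lambda>" and x: "x \<in> \<Lambda>"
    and uc: "u \<otimes> c \<ominus> \<one> = of_nat p \<odot> x"
  shows "u \<in> Units (loc_ring A \<Lambda> p)"
proof -
  note sub = subringE(3,6,7)[OF order_subring]
  note [simp] = order_carrier[OF u] order_carrier[OF c] order_carrier[OF x]
  let ?K = "(\<lambda>z. u \<otimes> z) ` \<Lambda>"
  have K: "additive_subgroup ?K A"
  proof (rule additive_subgroup_memI)
    show "\<zero> \<in> ?K"
      using \<Lambda>_zero by (intro image_eqI[of _ _ \<zero>]) auto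
    show "\<ominus> y \<in> ?K" if "y \<in> ?K" for y
      using that \<Lambda>_uminus by (auto simp flip: r_minus)
    show "y \<oplus> z \<in> ?K" if "y \<in> ?K" "z \<in> ?K" for y z
      using that \<Lambda>_add by (auto simp flip: r_distr)
  qed auto
  have F\<Lambda>: "f \<in> \<Lambda>" if "f \<in> F" for f
    unfolding fin_gen(3) using that by (rule generate.incl)
  have "\<exists>l\<in>generate (add_monoid A) F. f \<ominus> of_nat p \<odot> l \<in> ?K" if f: "f \<in> F" for f
  proof (rule bexI)
    have [simp]: "f \<in> carrier A"
      using f fin_gen(2) by blast
    have "u \<otimes> (c \<otimes> f) = (u \<otimes> c \<ominus> \<one>) \<otimes> f \<oplus> f"
      by (simp add: minus_eq l_distr l_minus m_assoc a_assoc l_neg)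
    also have "\<dots> = f \<ominus> of_nat p \<odot> (\<ominus> (x \<otimes> f))"
      unfolding uc by (simp add: smult_mult_left smult_neg minus_eq a_comm)
    finally show "f \<ominus> of_nat p \<odot> (\<ominus> (x \<otimes> f)) \<in> ?K"
      using sub(2)[OF c F\<Lambda>[OF f]] by (metis imageI)
    show "\<ominus> (x \<otimes> f) \<in> generate (add_monoid A) F"
      unfolding fin_gen(3)[symmetric] using sub(2)[OF x F\<Lambda>[OF f]] \<Lambda>_uminus by simp
  qed
  then obtain m where m: "coprime m (int p)" "\<And>f. f \<in> F \<Longrightarrow> of_int m \<odot> f \<in> ?K"
    using nakayama_generators[OF p fin_gen(1,2) K] by blast
  have "\<Lambda> \<subseteq> {x \<in> carrier A. of_int m \<odot> x \<in> ?K}"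
    unfolding fin_gen(3) using m(2) fin_gen(2) unfolding fin_gen(3)
    by (intro generate_least additive_subgroup_int_multiple) (use K fin_gen(3) in auto)
  then obtain z where z: "z \<in> \<Lambda>" "of_int m \<odot> \<one> = u \<otimes> z"
    using sub(1) by blast
  have m0: "m \<noteq> 0"
    using m(1) p by (auto simp: prime_nat_iff)
  define w where "w = (1 / of_int m) \<odot> z"
  have [simp]: "z \<in> carrier A" "w \<in> carrier A"
    using z(1) by (auto simp: w_def)
  have "of_int m \<odot> w = z"
    using m0 by (simp add: w_def smult_smult)
  then have w: "w \<in> \<Lambda>loc p"
    using z(1) m(1) by (auto simp: \<Lambda>loc_eq[OF p])
  have "u \<otimes> w = (1 / of_int m) \<odot> (of_int m \<odot> \<one>)"
    unfolding z(2) w_def by (simp add: smult_mult_right)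
  also have "\<dots> = \<one>"
    using m0 by (simp add: smult_smult)
  finally have "u \<otimes> w = \<one>" .
  moreover from this have "w \<otimes> u = \<one>"
    by (simp add: m_comm)
  moreover have "u \<in> \<Lambda>loc p"
    using u subset_localization[OF order_subset] by blast
  ultimately show ?thesis
    using w unfolding Units_def by auto
qed

section \<open>The natural map and the lifting of units\<close>

lemma \<Lambda>loc_subset: "\<Lambda>loc p \<subseteq> carrier A"
  by (rule additive_subgroup.a_subset[OF \<Lambda>loc_subgroup])

lemma subring_\<Lambda>loc:
  assumes p: "Factorial_Ring.prime p"
  shows "subring (\<Lambda>loc p) A"
proof (rule subringI)
  show "\<one> \<in> \<Lambda>loc p"
    using subset_localization[OF order_subset] subringE(3)[OF order_subring] by blast
  show "x \<otimes> y \<in> \<Lambda>loc p" if "x \<in> \<Lambda>loc p" "y \<in> \<Lambda>loc p" for x y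
    using localization_mult[OF p order_subgroup order_subgroup subringE(6)[OF order_subring] that] .
qed (use \<Lambda>loc_subset \<Lambda>loc_subgroup in
    \<open>auto intro: additive_subgroup.a_closed additive_subgroup.a_inv_closed\<close>)

lemma ideal_L: "ideal L (sub_ring A \<Lambda>)"
  by (rule ideal_in_subringI[OF order_subring ideal_subgroup ideal_subset ideal_absorb])

lemma ideal_Lloc:
  assumes p: "Factorial_Ring.prime p"
  shows "ideal (Lloc p) (loc_ring A \<Lambda> p)"
  by (rule ideal_in_subringI[OF subring_\<Lambda>loc[OF p] Lloc_subgroup localization_mono[OF ideal_subset]])
    (rule localization_mult[OF p order_subgroup ideal_subgroup ideal_absorb])

lemmas quot_L_simps = subring_quot_simps[OF order_subring ideal_L]
lemmas quot_Lloc_simps = subring_quot_simps[OF subring_\<Lambda>loc ideal_Lloc]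

lemma cring_quot_L: "cring (sub_ring A \<Lambda> Quot L)"
  by (rule cring_subring_quot[OF order_subring ideal_L])

lemma cring_quot_Lloc: "Factorial_Ring.prime p \<Longrightarrow> cring (loc_quot A \<Lambda> L p)"
  by (rule cring_subring_quot[OF subring_\<Lambda>loc ideal_Lloc])

lemma carrier_quot_Lloc_representatives:
  assumes p: "Factorial_Ring.prime p"
  shows "carrier (loc_quot A \<Lambda> L p) = (+>) (Lloc p) ` \<Lambda>"
  unfolding quot_Lloc_simps(1)[OF p p]
proof
  show "(+>) (Lloc p) ` \<Lambda>loc p \<subseteq> (+>) (Lloc p) ` \<Lambda>"
  proof clarify
    fix x assume x: "x \<in> \<Lambda>loc p"
    then obtain a where a: "a \<in> \<Lambda>" "a \<ominus> x \<in> Lloc p"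
      using localization_representative[OF p] by blast
    then have "Lloc p +> a = Lloc p +> x"
      using coset_eq_iff[OF Lloc_subgroup] x \<Lambda>loc_subset by (meson order_carrier subsetD)
    then show "Lloc p +> x \<in> (+>) (Lloc p) ` \<Lambda>"
      using a(1) by blast
  qed
qed (use subset_localization[OF order_subset] in blast)

lemma finite_quot_L: "finite (carrier (sub_ring A \<Lambda> Quot L))"
  unfolding quot_L_simps(1) by (rule finite_cosets[OF ideal_subgroup exponent_pos exponent])

lemma finite_quot_Lloc:
  assumes p: "Factorial_Ring.prime p"
  shows "finite (carrier (loc_quot A \<Lambda> L p))"
  unfolding carrier_quot_Lloc_representatives[OF p]
proof (rule finite_cosets[OF Lloc_subgroup exponent_pos])
  have "L \<subseteq> carrier A"
    using ideal_subset order_subset by blast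
  then show "of_int n \<odot> x \<in> Lloc p" if "x \<in> \<Lambda>" for x
    using exponent[OF that] subset_localization by blast
qed

text \<open>The lift is found along \<open>\<Lambda>/pL \<rightarrow> \<Lambda>/L\<close>: the source is finite, as \<open>p n\<close> maps \<open>\<Lambda>\<close> into \<open>pL\<close>, and a unit modulo
\<open>pL\<close> is a unit modulo \<open>p\<Lambda>\<close>.\<close>

lemma unit_mod_ideal_lifts_to_localization:
  assumes p: "Factorial_Ring.prime p" and a: "a \<in> \<Lambda>"
    and unit: "L +> a \<in> Units (sub_ring A \<Lambda> Quot L)"
  shows "\<exists>u\<in>\<Lambda>. L +> u = L +> a \<and> u \<in> Units (loc_ring A \<Lambda> p)"
proof -
  let ?K = "(\<lambda>x. of_nat p \<odot> x) ` L"
  note sub = subringE(3,6,7)[OF order_subring]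
  have L_carrier: "x \<in> carrier A" if "x \<in> L" for x
    using that ideal_subset by auto
  have KL: "?K \<subseteq> L"
    using int_smult_closed[OF ideal_subgroup, of _ "int p"] by auto
  have K: "additive_subgroup ?K A"
  proof (rule additive_subgroup_memI)
    show "?K \<subseteq> carrier A"
      using L_carrier by auto
    show "\<zero> \<in> ?K"
      using additive_subgroup.zero_closed[OF ideal_subgroup] by (intro image_eqI[of _ _ \<zero>]) auto
    show "\<ominus> y \<in> ?K" if "y \<in> ?K" for y
      using that L_carrier additive_subgroup.a_inv_closed[OF ideal_subgroup]
      by (auto simp flip: smult_neg)
    show "y \<oplus> z \<in> ?K" if "y \<in> ?K" "z \<in> ?K" for y z
      using that L_carrier L_add by (auto simp flip: smult_add_right)
  qed
  have K_ideal: "ideal ?K (sub_ring A \<Lambda>)"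
  proof (rule ideal_in_subringI[OF order_subring K])
    show "?K \<subseteq> \<Lambda>"
      using KL ideal_subset by blast
    show "b \<otimes> y \<in> ?K" if "b \<in> \<Lambda>" "y \<in> ?K" for b y
      using that L_carrier ideal_absorb by (auto simp: smult_mult_right)
  qed
  let ?R = "sub_ring A \<Lambda> Quot ?K" and ?S = "sub_ring A \<Lambda> Quot L"
  let ?h = "\<lambda>C. \<Union>b\<in>C. L +> b"
  note R_simps = subring_quot_simps[OF order_subring K_ideal]
  have fin: "finite (carrier ?R)"
    unfolding R_simps(1)
  proof (rule finite_cosets[OF K])
    show "int p * n > 0"
      using p exponent_pos prime_gt_0_nat by simp
    show "of_int (int p * n) \<odot> x \<in> ?K" if "x \<in> \<Lambda>" for x
      using exponent[OF that] that by (intro image_eqI[of _ _ "of_int n \<odot> x"]) (auto simp: smult_smult)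
  qed
  have h: "?h (?K +> b) = L +> b" if "b \<in> \<Lambda>" for b
    by (rule Union_cosets_eq[OF K ideal_subgroup KL order_carrier[OF that]])
  interpret h: ring_hom_cring ?R ?S ?h
    using quotient_map_ring_hom[OF order_subring K K_ideal ideal_subgroup ideal_L KL]
      cring_subring_quot[OF order_subring K_ideal] cring_quot_L
    by (intro ring_hom_cring.intro ring_hom_cring_axioms.intro)
  have Ka: "?K +> a \<in> carrier ?R"
    using a by (auto simp: R_simps)
  have "?h (?K +> a) \<in> Units ?S"
    unfolding h[OF a] by (rule unit)
  then obtain C where C: "C \<in> Units ?R" "?h C = ?h (?K +> a)"
    using h.finite_imp_unit_lifts[OF fin Ka] by blast
  then obtain D where D: "C \<in> carrier ?R" "D \<in> carrier ?R" "C \<otimes>\<^bsub>?R\<^esub> D = \<one>\<^bsub>?R\<^esub>"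
    by (auto simp: Units_def)
  obtain u c where u: "u \<in> \<Lambda>" "C = ?K +> u" and c: "c \<in> \<Lambda>" "D = ?K +> c"
    using D(1,2) unfolding R_simps(1) by blast
  have "?K +> (u \<otimes> c) = ?K +> \<one>"
    using D(3) u c by (simp add: R_simps)
  then have "u \<otimes> c \<ominus> \<one> \<in> ?K"
    using coset_eq_iff[OF K] u c by simp
  then obtain x where x: "x \<in> L" "u \<otimes> c \<ominus> \<one> = of_nat p \<odot> x"
    by blast
  have "u \<in> Units (loc_ring A \<Lambda> p)"
    using x ideal_subset by (intro unit_mod_prime_imp_unit_in_localization[OF p u(1) c(1) _ x(2)]) blast
  moreover have "L +> u = L +> a"
    using C(2) unfolding u(2) h[OF u(1)] h[OF a] .
  ultimately show ?thesis
    using u(1) by blast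
qed

lemma natural_map_coset:
  assumes a: "a \<in> \<Lambda>"
  shows "natural_map A L P (L +> a) = (\<lambda>p\<in>P. Lloc p +> a)"
proof -
  have "L \<subseteq> carrier A"
    using ideal_subset order_subset by blast
  then have "(\<Union>b\<in>L +> a. Lloc p +> b) = Lloc p +> a" for p
    by (intro Union_cosets_eq[OF ideal_subgroup Lloc_subgroup] subset_localization order_carrier a)
  then show ?thesis
    by (simp add: natural_map_def)
qed

lemma natural_map_ring_iso:
  "natural_map A L (differing_primes A \<Lambda> L) \<in> ring_iso (sub_ring A \<Lambda> Quot L) (product_ring (differing_primes A \<Lambda> L) (loc_quot A \<Lambda> L))"
proof -
  let ?R = "sub_ring A \<Lambda> Quot L" and ?S = "product_ring (differing_primes A \<Lambda> L) (loc_quot A \<Lambda> L)"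
  note sub = subringE(3,6,7)[OF order_subring]
  have prime: "Factorial_Ring.prime p" if "p \<in> differing_primes A \<Lambda> L" for p
    using that by (simp add: differing_primes_def)
  have \<Lambda>loc: "a \<in> \<Lambda>loc p" if "a \<in> \<Lambda>" for a p
    using that subset_localization[OF order_subset] by blast
  have "natural_map A L (differing_primes A \<Lambda> L) \<in> ring_hom ?R ?S"
  proof (rule ring_hom_memI)
    fix x y assume "x \<in> carrier ?R" "y \<in> carrier ?R"
    then obtain a b where ab: "a \<in> \<Lambda>" "x = L +> a" "b \<in> \<Lambda>" "y = L +> b"
      unfolding quot_L_simps(1) by blast
    show "natural_map A L (differing_primes A \<Lambda> L) (x \<otimes>\<^bsub>?R\<^esub> y) = natural_map A L (differing_primes A \<Lambda> L) x \<otimes>\<^bsub>?S\<^esub> natural_map A L (differing_primes A \<Lambda> L) y"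
      "natural_map A L (differing_primes A \<Lambda> L) (x \<oplus>\<^bsub>?R\<^esub> y) = natural_map A L (differing_primes A \<Lambda> L) x \<oplus>\<^bsub>?S\<^esub> natural_map A L (differing_primes A \<Lambda> L) y"
      using ab
      by (simp_all add: quot_L_simps natural_map_coset sub quot_Lloc_simps[OF prime prime] \<Lambda>loc
          cong: restrict_cong)
  next
    fix x assume "x \<in> carrier ?R"
    then obtain a where a: "a \<in> \<Lambda>" "x = L +> a"
      unfolding quot_L_simps(1) by blast
    then show "natural_map A L (differing_primes A \<Lambda> L) x \<in> carrier ?S"
      by (auto simp: natural_map_coset carrier_quot_Lloc_representatives[OF prime])
  next
    show "natural_map A L (differing_primes A \<Lambda> L) \<one>\<^bsub>?R\<^esub> = \<one>\<^bsub>?S\<^esub>"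
      by (simp add: quot_L_simps natural_map_coset sub quot_Lloc_simps[OF prime prime]
          cong: restrict_cong)
  qed
  moreover have "inj_on (natural_map A L (differing_primes A \<Lambda> L)) (carrier ?R)"
  proof (rule inj_onI)
    fix x y assume "x \<in> carrier ?R" "y \<in> carrier ?R"
      and eq: "natural_map A L (differing_primes A \<Lambda> L) x = natural_map A L (differing_primes A \<Lambda> L) y"
    then obtain a b where ab: "a \<in> \<Lambda>" "x = L +> a" "b \<in> \<Lambda>" "y = L +> b"
      unfolding quot_L_simps(1) by blast
    have diff: "a \<ominus> b \<in> \<Lambda>"
      by (rule additive_subgroup_minus[OF order_subgroup ab(1,3)])
    \<comment> \<open>at a prime where the localizations agree, membership in \<open>L\<^sub>(\<^sub>p\<^sub>)\<close> is automatic\<close>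
    have "a \<ominus> b \<in> Lloc p" if p: "Factorial_Ring.prime p" for p
    proof (cases "p \<in> differing_primes A \<Lambda> L")
      case True
      have "Lloc p +> a = Lloc p +> b"
        using fun_cong[OF eq, of p] ab True by (simp add: natural_map_coset)
      then show ?thesis
        using coset_eq_iff[OF Lloc_subgroup] ab by simp
    next
      case False
      then have "\<Lambda>loc p = Lloc p"
        using p by (simp add: differing_primes_def)
      then show ?thesis
        using \<Lambda>loc[OF diff] by blast
    qed
    then have "a \<ominus> b \<in> L"
      by (rule mem_ideal_if_locally[OF diff])
    then show "x = y"
      using coset_eq_iff[OF ideal_subgroup] ab by simp
  qed
  moreover have "f \<in> natural_map A L (differing_primes A \<Lambda> L) ` carrier ?R" if f: "f \<in> carrier ?S" for f
  proof -
    have "\<forall>p\<in>differing_primes A \<Lambda> L. \<exists>a\<in>\<Lambda>. f p = Lloc p +> a"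
    proof
      fix p assume p: "p \<in> differing_primes A \<Lambda> L"
      then have "f p \<in> carrier (loc_quot A \<Lambda> L p)"
        using f by (auto simp: PiE_iff)
      then show "\<exists>a\<in>\<Lambda>. f p = Lloc p +> a"
        unfolding carrier_quot_Lloc_representatives[OF prime[OF p]] by blast
    qed
    then obtain a where a: "\<And>p. p \<in> differing_primes A \<Lambda> L \<Longrightarrow> a p \<in> \<Lambda> \<and> f p = Lloc p +> a p"
      by (metis (no_types))
    then obtain x where x: "x \<in> \<Lambda>" "\<And>p. p \<in> differing_primes A \<Lambda> L \<Longrightarrow> x \<ominus> a p \<in> Lloc p"
      using chinese_remainder[OF finite_differing_primes, of a] prime by blast
    have fp: "f p = Lloc p +> x" if p: "p \<in> differing_primes A \<Lambda> L" for p
    proof -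
      have "Lloc p +> x = Lloc p +> a p"
        using coset_eq_iff[OF Lloc_subgroup] x a[OF p] p by simp
      then show ?thesis
        using a[OF p] by simp
    qed
    have "f = (\<lambda>p\<in>differing_primes A \<Lambda> L. f p)"
      using f by (simp add: PiE_restrict)
    also have "\<dots> = (\<lambda>p\<in>differing_primes A \<Lambda> L. Lloc p +> x)"
      using fp by (rule restrict_ext)
    also have "\<dots> = natural_map A L (differing_primes A \<Lambda> L) (L +> x)"
      using natural_map_coset[OF x(1)] by simp
    finally show ?thesis
      using x(1) unfolding quot_L_simps(1) by blast
  qed
  ultimately show ?thesis
    unfolding ring_iso_def bij_betw_def by (blast dest: ring_hom_memE(1))
qed

text \<open>The tuple with entry \<open>a1\<close> at \<open>p\<close> and \<open>1\<close> elsewhere is a unit of the product ring, so it comes from a unit of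
\<open>\<Lambda>/L\<close>; it remains to choose a good representative of that class.\<close>

lemma ex_unit_with_prescribed_residues:
  assumes p: "p \<in> differing_primes A \<Lambda> L" and a1: "Lloc p +> a1 \<in> Units (loc_quot A \<Lambda> L p)"
  shows "\<exists>u\<in>\<Lambda>. u \<in> Units (loc_ring A \<Lambda> p) \<and> L +> u \<in> Units (sub_ring A \<Lambda> Quot L) \<and>
    (\<forall>q\<in>differing_primes A \<Lambda> L. Lloc q +> u = (if q = p then Lloc p +> a1 else Lloc q +> \<one>))"
proof -
  let ?R = "sub_ring A \<Lambda> Quot L" and ?S = "product_ring (differing_primes A \<Lambda> L) (loc_quot A \<Lambda> L)"
  have prime: "Factorial_Ring.prime q" if "q \<in> differing_primes A \<Lambda> L" for q
    using that by (simp add: differing_primes_def)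
  let ?f = "\<lambda>q\<in>differing_primes A \<Lambda> L. if q = p then Lloc p +> a1 else Lloc q +> \<one>"
  have "Lloc q +> \<one> \<in> Units (loc_quot A \<Lambda> L q)" if "q \<in> differing_primes A \<Lambda> L" for q
    unfolding quot_Lloc_simps(4)[OF prime[OF that] prime[OF that], symmetric]
    by (intro monoid.Units_one_closed ring.is_monoid cring.axioms(1) cring_quot_Lloc prime that)
  then have "?f \<in> Units ?S"
    using a1 by (auto simp: Units_product_ring)
  moreover have "natural_map A L (differing_primes A \<Lambda> L) ` Units ?R = Units ?S"
    using ring_iso_imp_units_iso[OF natural_map_ring_iso cring.axioms(1)[OF cring_quot_L]
        cring.axioms(1)[OF cring_product_ring[OF cring_quot_Lloc[OF prime]]]]
    by (simp add: iso_def bij_betw_def units_of_carrier)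
  ultimately have "?f \<in> natural_map A L (differing_primes A \<Lambda> L) ` Units ?R"
    by simp
  then obtain C where C: "C \<in> Units ?R" "natural_map A L (differing_primes A \<Lambda> L) C = ?f"
    by (elim imageE) simp
  then have "C \<in> carrier ?R"
    by (auto simp: Units_def)
  then obtain a where a: "a \<in> \<Lambda>" "C = L +> a"
    unfolding quot_L_simps(1) by blast
  obtain u where u: "u \<in> \<Lambda>" "L +> u = L +> a" "u \<in> Units (loc_ring A \<Lambda> p)"
    using unit_mod_ideal_lifts_to_localization[OF prime[OF p] a(1)] C(1) a(2) by blast
  have "(\<lambda>q\<in>differing_primes A \<Lambda> L. Lloc q +> u) = ?f"
    using C(2) unfolding a(2) u(2)[symmetric] natural_map_coset[OF u(1)] .
  have "Lloc q +> u = (if q = p then Lloc p +> a1 else Lloc q +> \<one>)"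
    if "q \<in> differing_primes A \<Lambda> L" for q
  proof -
    have "(\<lambda>q\<in>differing_primes A \<Lambda> L. Lloc q +> u) q = ?f q"
      using \<open>(\<lambda>q\<in>differing_primes A \<Lambda> L. Lloc q +> u) = ?f\<close> by (rule fun_cong)
    then show ?thesis
      unfolding restrict_apply'[OF that] .
  qed
  moreover have "L +> u \<in> Units ?R"
    using C(1) unfolding a(2) u(2) .
  ultimately show ?thesis
    using u(1,3) by blast
qed

lemma localized_units_epi:
  assumes p: "p \<in> differing_primes A \<Lambda> L"
  shows "(\<lambda>a. Lloc p +> a) \<in> epi (units_of (loc_ring A \<Lambda> p)) (units_of (loc_quot A \<Lambda> L p))"
proof -
  let ?B = "loc_ring A \<Lambda> p" and ?Q = "loc_quot A \<Lambda> L p"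
  have prime: "Factorial_Ring.prime p"
    using p by (simp add: differing_primes_def)
  have hom: "(\<lambda>a. Lloc p +> a) \<in> ring_hom ?B ?Q"
    using ideal.rcos_ring_hom[OF ideal_Lloc[OF prime]] by simp
  have "(\<lambda>a. Lloc p +> a) \<in> hom (units_of ?B) (units_of ?Q)"
  proof (rule homI)
    show "Lloc p +> x \<in> carrier (units_of ?Q)" if "x \<in> carrier (units_of ?B)" for x
      using ring_hom_imp_Units[OF hom] that by (simp add: units_of_carrier)
    show "Lloc p +> (x \<otimes>\<^bsub>units_of ?B\<^esub> y) = (Lloc p +> x) \<otimes>\<^bsub>units_of ?Q\<^esub> (Lloc p +> y)"
      if "x \<in> carrier (units_of ?B)" "y \<in> carrier (units_of ?B)" for x y
      using ring_hom_memE(2)[OF hom, of x y] that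
      by (simp add: units_of_carrier units_of_mult Units_def)
  qed
  moreover have "C \<in> (\<lambda>a. Lloc p +> a) ` Units ?B" if C: "C \<in> Units ?Q" for C
  proof -
    have "C \<in> carrier ?Q"
      using C by (simp add: Units_def)
    then obtain a where a: "C = Lloc p +> a"
      unfolding quot_Lloc_simps(1)[OF prime prime] by blast
    then obtain u where u: "u \<in> Units ?B"
      and res: "\<forall>q\<in>differing_primes A \<Lambda> L. Lloc q +> u = (if q = p then Lloc p +> a else Lloc q +> \<one>)"
      using ex_unit_with_prescribed_residues[OF p, of a] C by blast
    have "C = Lloc p +> u"
      using res p a by simp
    then show ?thesis
      using u by blast
  qed
  ultimately show ?thesis
    by (auto simp: epi_iff_subset units_of_carrier)
qed

end

lemma order_with_ideal_exists:
  assumes A: "fin_dim_comm_rat_algebra A" and \<Lambda>: "is_order A \<Lambda>"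
    and L: "order_ideal A \<Lambda> L" "L \<subseteq> \<Lambda>"
  shows "\<exists>F n. order_with_ideal A \<Lambda> L F n"
proof -
  have alg: "algebra rat_ring A"
    using A by (simp add: fin_dim_comm_rat_algebra_def)
  interpret rat_algebra A
    by (intro rat_algebra.intro rat_algebra_axioms.intro algebra.M_cring[OF alg] alg)
  obtain F where F: "finite F" "F \<subseteq> carrier A" "\<Lambda> = generate (add_monoid A) F"
    using \<Lambda> by (auto simp: is_order_def full_lattice_def)
  obtain G where G: "G \<subseteq> carrier A" "L = generate (add_monoid A) G" and span: "rat_span A L = carrier A"
    using L by (auto simp: order_ideal_def full_lattice_def)
  have \<Lambda>_sub: "additive_subgroup \<Lambda> A"
    unfolding F(3) by (rule generate_additive_subgroup[OF F(2)])
  have L_sub: "additive_subgroup L A"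
    unfolding G(2) by (rule generate_additive_subgroup[OF G(1)])
  have "subring \<Lambda> A"
    using \<Lambda> additive_subgroup.a_subset[OF \<Lambda>_sub] additive_subgroup.a_closed[OF \<Lambda>_sub]
      additive_subgroup.a_inv_closed[OF \<Lambda>_sub]
    by (intro subringI) (auto simp: is_order_def)
  moreover obtain n where n: "n > 0" "\<And>x. x \<in> \<Lambda> \<Longrightarrow> of_int n \<odot>\<^bsub>A\<^esub> x \<in> L"
    using full_lattice_absorbs_finitely_generated[OF L_sub span F(1,2)] unfolding F(3) by blast
  moreover have "x \<otimes>\<^bsub>A\<^esub> y \<in> L" if "x \<in> \<Lambda>" "y \<in> L" for x y
    using L(1) that by (auto simp: order_ideal_def multiplier_ring_def)
  ultimately have "order_with_ideal A \<Lambda> L F n"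
    using F L_sub L(2)
    by (intro order_with_ideal.intro order_with_ideal_axioms.intro rat_algebra_axioms)
  then show ?thesis
    by blast
qed

theorem theorem7p6:
  fixes A :: "(rat, 'a, 'm) module_scheme" and \<Lambda> L :: "'a set" and P0 :: "nat set"
  assumes "fin_dim_comm_rat_algebra A"
    and "is_order A \<Lambda>"
    and "order_ideal A \<Lambda> L" and "L \<subseteq> \<Lambda>"
    and P0: "P0 = differing_primes A \<Lambda> L"
  shows "finite P0 \<and>
    \<comment> \<open>(a)\<close>
    cring (sub_ring A \<Lambda> Quot L) \<and> finite (carrier (sub_ring A \<Lambda> Quot L)) \<and>
    (\<forall>p\<in>P0. cring (loc_quot A \<Lambda> L p) \<and> finite (carrier (loc_quot A \<Lambda> L p))) \<and>
    cring (product_ring P0 (loc_quot A \<Lambda> L)) \<and>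
    finite (carrier (product_ring P0 (loc_quot A \<Lambda> L))) \<and>
    (\<forall>a\<in>\<Lambda>. natural_map A L P0 (L +>\<^bsub>A\<^esub> a) = (\<lambda>p\<in>P0. localization A p L +>\<^bsub>A\<^esub> a)) \<and>
    natural_map A L P0 \<in> ring_iso (sub_ring A \<Lambda> Quot L) (product_ring P0 (loc_quot A \<Lambda> L)) \<and>
    comm_group (units_of (sub_ring A \<Lambda> Quot L)) \<and>
    finite (carrier (units_of (sub_ring A \<Lambda> Quot L))) \<and>
    comm_group (product_group P0 (\<lambda>p. units_of (loc_quot A \<Lambda> L p))) \<and>
    finite (carrier (product_group P0 (\<lambda>p. units_of (loc_quot A \<Lambda> L p)))) \<and>
    natural_map A L P0 \<in> iso (units_of (sub_ring A \<Lambda> Quot L))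
      (product_group P0 (\<lambda>p. units_of (loc_quot A \<Lambda> L p))) \<and>
    \<comment> \<open>(b)\<close>
    (\<forall>p\<in>P0.
      (\<forall>a1\<in>localization A p \<Lambda>. localization A p L +>\<^bsub>A\<^esub> a1 \<in> Units (loc_quot A \<Lambda> L p) \<longrightarrow>
        (\<exists>a3 \<in> \<Lambda> \<inter> Units (loc_ring A \<Lambda> p).
          L +>\<^bsub>A\<^esub> a3 \<in> Units (sub_ring A \<Lambda> Quot L) \<and>
          localization A p L +>\<^bsub>A\<^esub> a3 = localization A p L +>\<^bsub>A\<^esub> a1 \<and>
          (\<forall>q\<in>P0 - {p}. localization A q L +>\<^bsub>A\<^esub> a3 = localization A q L +>\<^bsub>A\<^esub> \<one>\<^bsub>A\<^esub>) \<and>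
          natural_map A L P0 (L +>\<^bsub>A\<^esub> a3) =
            (\<lambda>q\<in>P0. if q = p then localization A p L +>\<^bsub>A\<^esub> a1
                    else \<one>\<^bsub>units_of (loc_quot A \<Lambda> L q)\<^esub>))) \<and>
      (\<lambda>a. localization A p L +>\<^bsub>A\<^esub> a) \<in>
        epi (units_of (loc_ring A \<Lambda> p)) (units_of (loc_quot A \<Lambda> L p)))"
proof -
  obtain F n where "order_with_ideal A \<Lambda> L F n"
    using order_with_ideal_exists[OF assms(1-4)] by blast
  then interpret order_with_ideal A \<Lambda> L F n .
  let ?R = "sub_ring A \<Lambda> Quot L" and ?Q = "loc_quot A \<Lambda> L"
  let ?S = "product_ring P0 ?Q"
  have prime: "Factorial_Ring.prime p" if "p \<in> P0" for p
    using that by (simp add: P0 differing_primes_def)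
  have fin: "finite P0"
    unfolding P0 by (rule finite_differing_primes)
  have S_cring: "cring ?S"
    by (rule cring_product_ring[OF cring_quot_Lloc[OF prime]])
  have S_fin: "finite (carrier ?S)"
    using fin finite_quot_Lloc[OF prime] by (simp add: finite_PiE)
  have iso: "natural_map A L P0 \<in> ring_iso ?R ?S"
    unfolding P0 by (rule natural_map_ring_iso)
  have units_fin: "finite (carrier (units_of B))" if "finite (carrier B)" for B :: "('c, 'd) ring_scheme"
    using that finite_subset[of "Units B" "carrier B"] by (auto simp: units_of_carrier Units_def)
  have quot_one: "\<one>\<^bsub>units_of (?Q q)\<^esub> = Lloc q +>\<^bsub>A\<^esub> \<one>\<^bsub>A\<^esub>" if "q \<in> P0" for q
    using quot_Lloc_simps(4)[OF prime[OF that] prime[OF that]] by (simp add: units_of_one)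
  have lift: "\<exists>a3 \<in> \<Lambda> \<inter> Units (loc_ring A \<Lambda> p).
          L +>\<^bsub>A\<^esub> a3 \<in> Units ?R \<and>
          Lloc p +>\<^bsub>A\<^esub> a3 = Lloc p +>\<^bsub>A\<^esub> a1 \<and>
          (\<forall>q\<in>P0 - {p}. Lloc q +>\<^bsub>A\<^esub> a3 = Lloc q +>\<^bsub>A\<^esub> \<one>\<^bsub>A\<^esub>) \<and>
          natural_map A L P0 (L +>\<^bsub>A\<^esub> a3) =
            (\<lambda>q\<in>P0. if q = p then Lloc p +>\<^bsub>A\<^esub> a1 else \<one>\<^bsub>units_of (?Q q)\<^esub>)"
    if p: "p \<in> P0" and a1: "Lloc p +>\<^bsub>A\<^esub> a1 \<in> Units (?Q p)" for p a1
  proof -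
    obtain u where u: "u \<in> \<Lambda>" "u \<in> Units (loc_ring A \<Lambda> p)" "L +>\<^bsub>A\<^esub> u \<in> Units ?R"
      and res: "\<And>q. q \<in> P0 \<Longrightarrow>
        Lloc q +>\<^bsub>A\<^esub> u = (if q = p then Lloc p +>\<^bsub>A\<^esub> a1 else Lloc q +>\<^bsub>A\<^esub> \<one>\<^bsub>A\<^esub>)"
      using ex_unit_with_prescribed_residues[OF p[unfolded P0] a1] unfolding P0 by blast
    have "natural_map A L P0 (L +>\<^bsub>A\<^esub> u) =
        (\<lambda>q\<in>P0. if q = p then Lloc p +>\<^bsub>A\<^esub> a1 else \<one>\<^bsub>units_of (?Q q)\<^esub>)"
      unfolding natural_map_coset[OF u(1)] by (intro restrict_ext) (simp add: res quot_one)
    moreover have "Lloc q +>\<^bsub>A\<^esub> u = Lloc q +>\<^bsub>A\<^esub> \<one>\<^bsub>A\<^esub>" if "q \<in> P0 - {p}" for q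
      using res[of q] that by simp
    moreover have "Lloc p +>\<^bsub>A\<^esub> u = Lloc p +>\<^bsub>A\<^esub> a1"
      using res[OF p] by simp
    ultimately show ?thesis
      using u by (intro bexI[of _ u] conjI ballI IntI)
  qed
  have units_group: "comm_group (units_of B)" if "cring B" for B :: "('c, 'd) ring_scheme"
    using that by (intro comm_monoid.units_comm_group cring.axioms(2))
  show ?thesis
    unfolding units_of_product_ring[symmetric]
  proof (intro conjI ballI impI)
    show "cring ?R" "finite (carrier ?R)" "finite P0" "cring ?S" "finite (carrier ?S)"
      using cring_quot_L finite_quot_L fin S_cring S_fin .
    show "comm_group (units_of ?R)" "finite (carrier (units_of ?R))"
      using units_group[OF cring_quot_L] units_fin[OF finite_quot_L] .
    show "comm_group (units_of ?S)" "finite (carrier (units_of ?S))"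
      using units_group[OF S_cring] units_fin[OF S_fin] .
    show "natural_map A L P0 \<in> ring_iso ?R ?S"
      by (rule iso)
    show "natural_map A L P0 \<in> iso (units_of ?R) (units_of ?S)"
      using ring_iso_imp_units_iso[OF iso cring.axioms(1)[OF cring_quot_L] cring.axioms(1)[OF S_cring]] .
    show "natural_map A L P0 (L +>\<^bsub>A\<^esub> a) = (\<lambda>p\<in>P0. Lloc p +>\<^bsub>A\<^esub> a)" if "a \<in> \<Lambda>" for a
      by (rule natural_map_coset[OF that])
  next
    fix p assume p: "p \<in> P0"
    show "cring (?Q p)" "finite (carrier (?Q p))"
      using cring_quot_Lloc[OF prime[OF p]] finite_quot_Lloc[OF prime[OF p]] .
    show "(\<lambda>a. Lloc p +>\<^bsub>A\<^esub> a) \<in> epi (units_of (loc_ring A \<Lambda> p)) (units_of (?Q p))"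
      using localized_units_epi p unfolding P0 .
  qed (rule lift)
qed

end
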